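(* (Analytic LLPO.) In the topos $\mathcal{T}_\mu$, every Dedekind real is non-negative or non-positive: $\forall x\in\mathbb{R}_d\,(x\ge0\vee x\le0)$ is valid.
   Context: Oracle computability. For $\alpha\in2^{\mathbb{N}}$ let $\varphi^\alpha_m$ enumerate the partial $\alpha$-computable functions $\mathbb{N}\rightharpoonup\mathbb{N}$, with indices independent of $\alpha$. Fix computable bijections $\langle\cdot,\cdot\rangle:\mathbb{N}^2\to\mathbb{N}$ and $n\mapsto q_n:\mathbb{N}\to\mathbb{Q}$. A function $g$ represents $x$ if $|x-q_{g(n)}|<2^{-n}$ for all $n$. Let $r(\alpha)=\sum_i\alpha(i)2^{-i-1}$ and $s(\alpha)(n)=r(m\mapsto\alpha(\langle n,m\rangle))$. For $a:\mathbb{N}\to[0,1]$, $n$ is an $a$-index if a single real is represented by a total $\varphi^\alpha_n$ for all $\alpha\in s^{-1}(a)$. Fix a Miller sequence $\mu$ (every $\mu$-index $n$ represents $\mu(n)$) and put $M_\mu=s^{-1}(\mu)$. A ppca $(A,P)$ is a set $A$, a nonempty set $P$, and partial applications $a\cdot_pb$ such that some $k,s\in A$ satisfy, for all $p,q,a,b,c$: - $k\cdot_pa=k\cdot_qa$; - $(k\cdot_pa)\cdot_pb=a$; - $s\cdot_pa=s\cdot_qa$; - $(s\cdot_pa)\cdot_pb=(s\cdot_qa)\cdot_qb$ (all these defined); - $((s\cdot_pa)\cdot_pb)\cdot_pc\simeq(a\cdot_pc)\cdot_p(b\cdot_pc)$. Its tripos sends $X$ to $\mathcal{P}(A)^X$,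 with $\phi\le\psi$ iff some $a$ satisfies $a\cdot_pb\in\psi(x)$ for all $x$, $b\in\phi(x)$ and $p$. The logical operations are: - $\top=A$ and $\bot=\emptyset$; - pairs realize conjunctions, boolean-tagged pairs realize disjunctions, uniformly in $p$; - $(\phi\to\psi)(x)=\{a\mid\forall p\,\forall b\in\phi(x):a\cdot_pb\in\psi(x)\}$; - $(\exists_r\phi)(x)=\bigcup_{r(y)=x}\phi(y)$; - $(\forall_r\phi)(x)=\{a\mid\forall y(r(y)=x\Rightarrow\forall b\,\forall q:a\cdot_qb\in\phi(y))\}$. $\mathcal{T}_\mu$ is the topos obtained by the tripos-to-topos construction from the tripos of the ppca with carrier $\mathbb{N}$, parameters $M_\mu$ and $m\cdot_\alpha n=\varphi^\alpha_m(n)$. $\mathbb{R}_d$ is its object of Dedekind reals. *)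

theory Defs
  imports Complex_Main "HOL-Library.Nat_Bijection"
begin

section \<open>Oracle computability\<close>

text \<open>Programs for the partial recursive functions relative to an oracle. \<open>PrimRec\<close> recurses on
  the first argument, and \<open>Mini\<close> searches for a value of the first argument.\<close>

datatype prog =
    Zero | Succ | Proj nat | Oracle
  | Comp prog "prog list" | PrimRec prog prog | Mini prog

fun peval :: "(nat \<Rightarrow> bool) \<Rightarrow> prog \<Rightarrow> nat list \<Rightarrow> nat option" where
  "peval \<alpha> Zero xs = Some 0"
| "peval \<alpha> Succ xs = (case xs of [] \<Rightarrow> None | x # _ \<Rightarrow> Some (Suc x))"
| "peval \<alpha> (Proj i) xs = (if i < length xs then Some (xs ! i) else None)"
| "peval \<alpha> Oracle xs = (case xs of [] \<Rightarrow> None | x # _ \<Rightarrow> Some (of_bool (\<alpha> x)))"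
| "peval \<alpha> (Comp f gs) xs =
     (if \<forall>g\<in>set gs. peval \<alpha> g xs \<noteq> None
      then peval \<alpha> f (map (\<lambda>g. the (peval \<alpha> g xs)) gs) else None)"
| "peval \<alpha> (PrimRec f g) xs =
     (case xs of [] \<Rightarrow> None
      | n # ys \<Rightarrow> rec_nat (peval \<alpha> f ys) (\<lambda>k v. Option.bind v (\<lambda>y. peval \<alpha> g (k # y # ys))) n)"
| "peval \<alpha> (Mini f) xs =
     (if \<exists>n. peval \<alpha> f (n # xs) = Some 0 \<and> (\<forall>k<n. \<exists>v>0. peval \<alpha> f (k # xs) = Some v)
      then Some (LEAST n. peval \<alpha> f (n # xs) = Some 0) else None)"

text \<open>A program that computes the same function for all oracles computes it with the
  constant oracle, so the following are the computable functions without oracle.\<close>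

definition computable :: "(nat \<Rightarrow> nat) \<Rightarrow> bool" where
  "computable f \<longleftrightarrow> (\<exists>e. \<forall>\<alpha> n. peval \<alpha> e [n] = Some (f n))"

definition computable2 :: "(nat \<Rightarrow> nat \<Rightarrow> nat) \<Rightarrow> bool" where
  "computable2 f \<longleftrightarrow> (\<exists>e. \<forall>\<alpha> m n. peval \<alpha> e [m, n] = Some (f m n))"

text \<open>The acceptable enumerations of the partial \<open>\<alpha>\<close>-computable functions, uniformly
  in \<open>\<alpha>\<close>: the universal program and the reindexing function \<open>c\<close> of the s-m-n property do not
  depend on \<open>\<alpha>\<close>. An \<open>e\<close> that ignores \<open>m\<close> shows that every partial \<open>\<alpha>\<close>-computable function
  occurs, with the same index for every \<open>\<alpha>\<close>.\<close>

definition acceptable :: "((nat \<Rightarrow> bool) \<Rightarrow> nat \<Rightarrow> nat \<Rightarrow> nat option) \<Rightarrow> bool" where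
  "acceptable \<phi> \<longleftrightarrow>
     (\<exists>u. \<forall>\<alpha> m n. \<phi> \<alpha> m n = peval \<alpha> u [m, n]) \<and>
     (\<forall>e. \<exists>c. computable c \<and> (\<forall>\<alpha> m n. \<phi> \<alpha> (c m) n = peval \<alpha> e [m, n]))"

definition computable_pairing :: "(nat \<Rightarrow> nat \<Rightarrow> nat) \<Rightarrow> bool" where
  "computable_pairing pr \<longleftrightarrow> bij (\<lambda>(m, n). pr m n) \<and> computable2 pr"

definition computable_rat_enum :: "(nat \<Rightarrow> rat) \<Rightarrow> bool" where
  "computable_rat_enum q \<longleftrightarrow> bij q \<and>
     computable (\<lambda>n. int_encode (fst (quotient_of (q n)))) \<and>
     computable (\<lambda>n. nat (snd (quotient_of (q n))))"


section \<open>Miller sequences\<close>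

text \<open>For a partial \<open>g\<close>, the condition includes that \<open>g\<close> is total.\<close>

definition represents :: "(nat \<Rightarrow> rat) \<Rightarrow> (nat \<Rightarrow> nat option) \<Rightarrow> real \<Rightarrow> bool" where
  "represents q g x \<longleftrightarrow> (\<forall>n. \<exists>k. g n = Some k \<and> \<bar>x - of_rat (q k)\<bar> < (1/2) ^ n)"

definition bin_real :: "(nat \<Rightarrow> bool) \<Rightarrow> real" where
  "bin_real \<alpha> = (\<Sum>i. of_bool (\<alpha> i) * (1/2) ^ (i + 1))"

definition bin_seq :: "(nat \<Rightarrow> nat \<Rightarrow> nat) \<Rightarrow> (nat \<Rightarrow> bool) \<Rightarrow> nat \<Rightarrow> real" where
  "bin_seq pr \<alpha> n = bin_real (\<lambda>m. \<alpha> (pr n m))"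

definition seq_oracles :: "(nat \<Rightarrow> nat \<Rightarrow> nat) \<Rightarrow> (nat \<Rightarrow> real) \<Rightarrow> (nat \<Rightarrow> bool) set" where
  "seq_oracles pr a = bin_seq pr -` {a}"

text \<open>Indices are taken for reals in the unit interval, in which the sequences live: an index
  of, say, the constant function representing \<open>2\<close> is not an index in this sense. Otherwise no
  sequence in the unit interval could be a Miller sequence.\<close>

definition seq_index ::
    "((nat \<Rightarrow> bool) \<Rightarrow> nat \<Rightarrow> nat \<Rightarrow> nat option) \<Rightarrow> (nat \<Rightarrow> nat \<Rightarrow> nat) \<Rightarrow> (nat \<Rightarrow> rat) \<Rightarrow>
     (nat \<Rightarrow> real) \<Rightarrow> nat \<Rightarrow> real \<Rightarrow> bool" where
  "seq_index \<phi> pr q a n x \<longleftrightarrow>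
     x \<in> {0..1} \<and> (\<forall>\<alpha>\<in>seq_oracles pr a. represents q (\<phi> \<alpha> n) x)"

definition miller ::
    "((nat \<Rightarrow> bool) \<Rightarrow> nat \<Rightarrow> nat \<Rightarrow> nat option) \<Rightarrow> (nat \<Rightarrow> nat \<Rightarrow> nat) \<Rightarrow> (nat \<Rightarrow> rat) \<Rightarrow>
     (nat \<Rightarrow> real) \<Rightarrow> bool" where
  "miller \<phi> pr q \<mu> \<longleftrightarrow>
     (\<forall>n. \<mu> n \<in> {0..1}) \<and>
     (\<forall>n. (\<exists>x. seq_index \<phi> pr q \<mu> n x) \<longrightarrow> seq_index \<phi> pr q \<mu> n (\<mu> n))"


section \<open>Parameterized partial combinatory algebras\<close>

record ('p, 'a) app_struct =
  params :: "'p set"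
  app :: "'p \<Rightarrow> 'a \<Rightarrow> 'a \<Rightarrow> 'a option"

definition oapp :: "('p, 'a) app_struct \<Rightarrow> 'p \<Rightarrow> 'a option \<Rightarrow> 'a option \<Rightarrow> 'a option" where
  "oapp T p u v = Option.bind u (\<lambda>a. Option.bind v (app T p a))"

definition ks_combinators :: "('p, 'a) app_struct \<Rightarrow> 'a \<Rightarrow> 'a \<Rightarrow> bool" where
  "ks_combinators T k s \<longleftrightarrow> (\<forall>p\<in>params T. \<forall>q\<in>params T. \<forall>a b c.
     app T p k a = app T q k a \<and>
     oapp T p (app T p k a) (Some b) = Some a \<and>
     app T p s a \<noteq> None \<and>
     app T p s a = app T q s a \<and>
     oapp T p (app T p s a) (Some b) \<noteq> None \<and>
     oapp T p (app T p s a) (Some b) = oapp T q (app T q s a) (Some b) \<and>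
     oapp T p (oapp T p (app T p s a) (Some b)) (Some c) =
       oapp T p (app T p a c) (app T p b c))"

definition ppca :: "('p, 'a) app_struct \<Rightarrow> bool" where
  "ppca T \<longleftrightarrow> params T \<noteq> {} \<and> (\<exists>k s. ks_combinators T k s)"

text \<open>A choice of \<open>k\<close> and \<open>s\<close>. The applications \<open>k \<cdot> a\<close>, \<open>s \<cdot> a\<close> and \<open>(s \<cdot> a) \<cdot> b\<close> do not
  depend on the parameter.\<close>

definition ks :: "('p, 'a) app_struct \<Rightarrow> 'a \<times> 'a" where
  "ks T = (SOME (k, s). ks_combinators T k s)"

definition cK :: "('p, 'a) app_struct \<Rightarrow> 'a" where "cK T = fst (ks T)"
definition cS :: "('p, 'a) app_struct \<Rightarrow> 'a" where "cS T = snd (ks T)"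

definition some_param :: "('p, 'a) app_struct \<Rightarrow> 'p" where
  "some_param T = (SOME p. p \<in> params T)"

definition cK1 :: "('p, 'a) app_struct \<Rightarrow> 'a \<Rightarrow> 'a" where
  "cK1 T a = the (app T (some_param T) (cK T) a)"

definition cS1 :: "('p, 'a) app_struct \<Rightarrow> 'a \<Rightarrow> 'a" where
  "cS1 T a = the (app T (some_param T) (cS T) a)"

definition cS2 :: "('p, 'a) app_struct \<Rightarrow> 'a \<Rightarrow> 'a \<Rightarrow> 'a" where
  "cS2 T a b = the (app T (some_param T) (cS1 T a) b)"

definition cI :: "('p, 'a) app_struct \<Rightarrow> 'a" where
  "cI T = cS2 T (cK T) (cK T)"

text \<open>The element \<open>\<lambda>z. (z \<cdot> a) \<cdot> b\<close>.\<close>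

definition cpair :: "('p, 'a) app_struct \<Rightarrow> 'a \<Rightarrow> 'a \<Rightarrow> 'a" where
  "cpair T a b = cS2 T (cS2 T (cI T) (cK1 T a)) (cK1 T b)"

definition ctrue :: "('p, 'a) app_struct \<Rightarrow> 'a" where "ctrue T = cK T"
definition cfalse :: "('p, 'a) app_struct \<Rightarrow> 'a" where "cfalse T = cK1 T (cI T)"


section \<open>The tripos\<close>

text \<open>A predicate on \<open>'x\<close> is a function \<open>'x \<Rightarrow> 'a set\<close>. The connectives act pointwise and are
  defined at a point. The quantifiers are given along an arbitrary reindexing function \<open>r\<close>;
  \<open>t_All\<close> and \<open>t_Ex\<close> are their values along a projection, at a point of the base.\<close>

definition entails :: "('p, 'a) app_struct \<Rightarrow> ('x \<Rightarrow> 'a set) \<Rightarrow> ('x \<Rightarrow> 'a set) \<Rightarrow> bool"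
    (infix "\<^bold>\<le>\<index>" 20) where
  "(\<phi> \<^bold>\<le> \<psi>) \<longleftrightarrow> (\<exists>a. \<forall>x. \<forall>b\<in>\<phi> x. \<forall>p\<in>params T. \<exists>c\<in>\<psi> x. app T p a b = Some c)"
  for T (structure)

definition t_conj :: "('p, 'a) app_struct \<Rightarrow> 'a set \<Rightarrow> 'a set \<Rightarrow> 'a set" (infixr "\<^bold>\<and>\<index>" 35) where
  "(U \<^bold>\<and> V) = {cpair T a b | a b. a \<in> U \<and> b \<in> V}" for T (structure)

definition t_disj :: "('p, 'a) app_struct \<Rightarrow> 'a set \<Rightarrow> 'a set \<Rightarrow> 'a set" (infixr "\<^bold>\<or>\<index>" 30) where
  "(U \<^bold>\<or> V) = {cpair T (ctrue T) a | a. a \<in> U} \<union> {cpair T (cfalse T) b | b. b \<in> V}"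
  for T (structure)

definition t_imp :: "('p, 'a) app_struct \<Rightarrow> 'a set \<Rightarrow> 'a set \<Rightarrow> 'a set" (infixr "\<^bold>\<longrightarrow>\<index>" 25) where
  "(U \<^bold>\<longrightarrow> V) = {a. \<forall>p\<in>params T. \<forall>b\<in>U. \<exists>c\<in>V. app T p a b = Some c}" for T (structure)

definition t_iff :: "('p, 'a) app_struct \<Rightarrow> 'a set \<Rightarrow> 'a set \<Rightarrow> 'a set" (infixr "\<^bold>\<longleftrightarrow>\<index>" 25) where
  "(U \<^bold>\<longleftrightarrow> V) = ((U \<^bold>\<longrightarrow> V) \<^bold>\<and> (V \<^bold>\<longrightarrow> U))" for T (structure)

definition t_not :: "('p, 'a) app_struct \<Rightarrow> 'a set \<Rightarrow> 'a set" ("\<^bold>\<not>\<index> _" [40] 40) where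
  "(\<^bold>\<not> U) = (U \<^bold>\<longrightarrow> {})" for T (structure)

definition t_ex_along :: "('y \<Rightarrow> 'x) \<Rightarrow> ('y \<Rightarrow> 'a set) \<Rightarrow> 'x \<Rightarrow> 'a set" where
  "t_ex_along r \<phi> x = (\<Union>y\<in>{y. r y = x}. \<phi> y)"

definition t_all_along ::
    "('p, 'a) app_struct \<Rightarrow> ('y \<Rightarrow> 'x) \<Rightarrow> ('y \<Rightarrow> 'a set) \<Rightarrow> 'x \<Rightarrow> 'a set" where
  "t_all_along T r \<phi> x =
     {a. \<forall>y. r y = x \<longrightarrow> (\<forall>b. \<forall>q\<in>params T. \<exists>c\<in>\<phi> y. app T q a b = Some c)}"

definition t_Ex :: "('y \<Rightarrow> 'a set) \<Rightarrow> 'a set" where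
  "t_Ex \<phi> = t_ex_along (\<lambda>_. ()) \<phi> ()"

definition t_All :: "('p, 'a) app_struct \<Rightarrow> ('y \<Rightarrow> 'a set) \<Rightarrow> 'a set" ("\<^bold>\<forall>\<index>") where
  "\<^bold>\<forall> \<phi> = t_all_along T (\<lambda>_. ()) \<phi> ()" for T (structure)

definition valid :: "('p, 'a) app_struct \<Rightarrow> 'a set \<Rightarrow> bool" ("\<^bold>\<turnstile>\<index> _" [5] 5) where
  "(\<^bold>\<turnstile> U) \<longleftrightarrow> ((\<lambda>_ :: unit. UNIV) \<^bold>\<le> (\<lambda>_. U))" for T (structure)


section \<open>The topos\<close>

text \<open>An object is a type with an equality predicate \<open>E\<close>, symmetric and transitive in the logic
  of the tripos; \<open>E x x\<close> expresses that \<open>x\<close> exists. The subobjects of \<open>E\<close> are the strict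
  extensional predicates on its carrier, up to equivalence, so the formulas of the internal
  language are predicates of the tripos whose quantifiers over \<open>E\<close> are relativized to \<open>E x x\<close>.
  Functional relations, the arrows of the topos, are not needed.\<close>

definition topos_object :: "('p, 'a) app_struct \<Rightarrow> ('x \<Rightarrow> 'x \<Rightarrow> 'a set) \<Rightarrow> bool" where
  "topos_object T E \<longleftrightarrow>
     (\<^bold>\<turnstile> \<^bold>\<forall> (\<lambda>x. \<^bold>\<forall> (\<lambda>y. E x y \<^bold>\<longrightarrow> E y x))) \<and>
     (\<^bold>\<turnstile> \<^bold>\<forall> (\<lambda>x. \<^bold>\<forall> (\<lambda>y. \<^bold>\<forall> (\<lambda>z. E x y \<^bold>\<and> E y z \<^bold>\<longrightarrow> E x z))))"
  for T (structure)

definition all_in ::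
    "('p, 'a) app_struct \<Rightarrow> ('x \<Rightarrow> 'x \<Rightarrow> 'a set) \<Rightarrow> ('x \<Rightarrow> 'a set) \<Rightarrow> 'a set" where
  "all_in T E \<phi> = \<^bold>\<forall> (\<lambda>x. E x x \<^bold>\<longrightarrow> \<phi> x)" for T (structure)

definition ex_in ::
    "('p, 'a) app_struct \<Rightarrow> ('x \<Rightarrow> 'x \<Rightarrow> 'a set) \<Rightarrow> ('x \<Rightarrow> 'a set) \<Rightarrow> 'a set" where
  "ex_in T E \<phi> = t_Ex (\<lambda>x. E x x \<^bold>\<and> \<phi> x)" for T (structure)

definition t_strict ::
    "('p, 'a) app_struct \<Rightarrow> ('x \<Rightarrow> 'x \<Rightarrow> 'a set) \<Rightarrow> ('x \<Rightarrow> 'a set) \<Rightarrow> 'a set" where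
  "t_strict T E R = \<^bold>\<forall> (\<lambda>x. R x \<^bold>\<longrightarrow> E x x)" for T (structure)

definition t_extensional ::
    "('p, 'a) app_struct \<Rightarrow> ('x \<Rightarrow> 'x \<Rightarrow> 'a set) \<Rightarrow> ('x \<Rightarrow> 'a set) \<Rightarrow> 'a set" where
  "t_extensional T E R = \<^bold>\<forall> (\<lambda>x. \<^bold>\<forall> (\<lambda>y. R x \<^bold>\<and> E x y \<^bold>\<longrightarrow> R y))" for T (structure)

definition power_object ::
    "('p, 'a) app_struct \<Rightarrow> ('x \<Rightarrow> 'x \<Rightarrow> 'a set) \<Rightarrow> ('x \<Rightarrow> 'a set) \<Rightarrow> ('x \<Rightarrow> 'a set) \<Rightarrow> 'a set" where
  "power_object T E R S =
     (t_strict T E R \<^bold>\<and> t_extensional T E R \<^bold>\<and> \<^bold>\<forall> (\<lambda>x. R x \<^bold>\<longleftrightarrow> S x))"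
  for T (structure)

definition truth_value :: "bool \<Rightarrow> 'a set" where
  "truth_value P = {a. P}"

text \<open>The object of rationals, for the carrier \<open>nat\<close>. Numbers realize themselves in the natural
  numbers object, and this is its transport along the enumeration \<open>q\<close>. On it, the order is the
  decidable relation \<open>truth_value (a < b)\<close>.\<close>

definition rat_object :: "(nat \<Rightarrow> rat) \<Rightarrow> rat \<Rightarrow> rat \<Rightarrow> nat set" where
  "rat_object q a b = {n. q n = a \<and> a = b}"

definition rat_all :: "('p, nat) app_struct \<Rightarrow> (nat \<Rightarrow> rat) \<Rightarrow> (rat \<Rightarrow> nat set) \<Rightarrow> nat set" where
  "rat_all T q = all_in T (rat_object q)"

definition rat_ex :: "('p, nat) app_struct \<Rightarrow> (nat \<Rightarrow> rat) \<Rightarrow> (rat \<Rightarrow> nat set) \<Rightarrow> nat set" where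
  "rat_ex T q = ex_in T (rat_object q)"

type_synonym cut = "(rat \<Rightarrow> nat set) \<times> (rat \<Rightarrow> nat set)"

text \<open>The subsets \<open>L\<close> and \<open>U\<close> are inhabited and rounded, disjoint and located.\<close>

definition dedekind_cut :: "('p, nat) app_struct \<Rightarrow> (nat \<Rightarrow> rat) \<Rightarrow> cut \<Rightarrow> nat set" where
  "dedekind_cut T q = (\<lambda>(L, U).
     rat_ex T q L \<^bold>\<and> rat_ex T q U \<^bold>\<and>
     rat_all T q (\<lambda>a. L a \<^bold>\<longleftrightarrow> rat_ex T q (\<lambda>b. truth_value (a < b) \<^bold>\<and> L b)) \<^bold>\<and>
     rat_all T q (\<lambda>b. U b \<^bold>\<longleftrightarrow> rat_ex T q (\<lambda>a. truth_value (a < b) \<^bold>\<and> U a)) \<^bold>\<and>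
     rat_all T q (\<lambda>a. \<^bold>\<not> (L a \<^bold>\<and> U a)) \<^bold>\<and>
     rat_all T q (\<lambda>a. rat_all T q (\<lambda>b. truth_value (a < b) \<^bold>\<longrightarrow> L a \<^bold>\<or> U b)))"
  for T (structure)

text \<open>The subobject of Dedekind cuts of the product of two copies of the power object of the
  rationals.\<close>

definition dedekind_reals :: "('p, nat) app_struct \<Rightarrow> (nat \<Rightarrow> rat) \<Rightarrow> cut \<Rightarrow> cut \<Rightarrow> nat set" where
  "dedekind_reals T q x y =
     (power_object T (rat_object q) (fst x) (fst y) \<^bold>\<and>
      power_object T (rat_object q) (snd x) (snd y) \<^bold>\<and> dedekind_cut T q x)"
  for T (structure)

definition real_le :: "('p, nat) app_struct \<Rightarrow> (nat \<Rightarrow> rat) \<Rightarrow> cut \<Rightarrow> cut \<Rightarrow> nat set" where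
  "real_le T q x y =
     (rat_all T q (\<lambda>a. fst x a \<^bold>\<longrightarrow> fst y a) \<^bold>\<and> rat_all T q (\<lambda>b. snd y b \<^bold>\<longrightarrow> snd x b))"
  for T (structure)

definition rat_cut :: "('p, nat) app_struct \<Rightarrow> (nat \<Rightarrow> rat) \<Rightarrow> rat \<Rightarrow> cut" where
  "rat_cut T q r =
     ((\<lambda>a. rat_object q a a \<^bold>\<and> truth_value (a < r)), (\<lambda>b. rat_object q b b \<^bold>\<and> truth_value (r < b)))"
  for T (structure)


section \<open>The structure given by oracle computability\<close>

definition oracle_struct ::
    "((nat \<Rightarrow> bool) \<Rightarrow> nat \<Rightarrow> nat \<Rightarrow> nat option) \<Rightarrow> (nat \<Rightarrow> bool) set \<Rightarrow> (nat \<Rightarrow> bool, nat) app_struct" where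
  "oracle_struct \<phi> M = \<lparr>params = M, app = \<phi>\<rparr>"


section \<open>The structure is a ppca\<close>

definition pAdd :: prog where "pAdd = PrimRec (Proj 0) (Comp Succ [Proj 1])"
definition pPred :: prog where "pPred = Comp (PrimRec Zero (Proj 0)) [Proj 0]"
definition pRSub :: prog where "pRSub = PrimRec (Proj 0) (Comp pPred [Proj 1])"
definition pTri :: prog where "pTri = PrimRec Zero (Comp Succ [Comp pAdd [Proj 0, Proj 1]])"
definition pPair :: prog where
  "pPair = Comp pAdd [Comp pTri [Comp pAdd [Proj 0, Proj 1]], Proj 0]"
definition pRoot :: prog where
  "pRoot = Mini (Comp pRSub [Comp pTri [Comp Succ [Proj 0]], Comp Succ [Proj 1]])"
definition pFst :: prog where
  "pFst = Comp pRSub [Comp pTri [pRoot], Proj 0]"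
definition pSnd :: prog where
  "pSnd = Comp pRSub [pFst, pRoot]"

lemma peval_pAdd: "peval \<alpha> pAdd [m, n] = Some (m + n)"
  unfolding pAdd_def by (induction m) simp_all

lemma peval_pPred: "peval \<alpha> pPred (m # xs) = Some (m - 1)"
proof -
  have "peval \<alpha> (PrimRec Zero (Proj 0)) [m] = Some (m - 1)"
    by (induction m) simp_all
  then show ?thesis by (simp add: pPred_def del: peval.simps(6))
qed

lemma peval_pRSub: "peval \<alpha> pRSub [m, n] = Some (n - m)"
  unfolding pRSub_def by (induction m) (simp_all add: peval_pPred)

lemma peval_pTri: "peval \<alpha> pTri [m] = Some (triangle m)"
  unfolding pTri_def by (induction m) (simp_all add: peval_pAdd)

lemma peval_pPair: "peval \<alpha> pPair [m, n] = Some (prod_encode (m, n))"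
  by (simp add: pPair_def peval_pAdd peval_pTri prod_encode_def)

lemma peval_pRoot:
  "peval \<alpha> pRoot [prod_encode (m, n)] = Some (m + n)"
proof -
  let ?z = "prod_encode (m, n)"
  have e: "peval \<alpha> (Comp pRSub [Comp pTri [Comp Succ [Proj 0]], Comp Succ [Proj 1]]) [w, ?z] =
      Some (Suc ?z - triangle (Suc w))" for w
    by (simp only: peval.simps) (simp add: peval_pRSub peval_pTri)
  have mono: "triangle a \<le> triangle b" if "a \<le> b" for a b
    using that by (induction b rule: dec_induct) simp_all
  have 1: "Suc ?z \<le> triangle (Suc (m + n))"
    by (simp add: prod_encode_def)
  have 2: "triangle (Suc w) < Suc ?z" if "w < m + n" for w
    using mono[of "Suc w" "m + n"] that by (simp add: prod_encode_def)
  have ex: "\<exists>w. Suc ?z - triangle (Suc w) = 0 \<and> (\<forall>k<w. \<exists>v>0. Suc ?z - triangle (Suc k) = v)"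
    using 1 2 by (intro exI[of _ "m + n"]) (metis diff_is_0_eq zero_less_diff)
  have "(LEAST w. Suc ?z - triangle (Suc w) = 0) = m + n"
    using 1 2 by (intro Least_equality) (metis diff_is_0_eq, metis diff_is_0_eq not_le)
  with ex show ?thesis
    unfolding pRoot_def peval.simps(7) e by (auto simp del: triangle_Suc)
qed

lemma peval_pFst: "peval \<alpha> pFst [prod_encode (m, n)] = Some m"
  by (simp add: pFst_def peval_pRoot peval_pTri peval_pRSub) (simp add: prod_encode_def)

lemma peval_pSnd: "peval \<alpha> pSnd [prod_encode (m, n)] = Some n"
  by (simp add: pSnd_def peval_pRoot peval_pFst peval_pRSub)

lemma acceptable_k:
  assumes "acceptable \<phi>"
  obtains k c where "\<And>\<alpha> a. \<phi> \<alpha> k a = Some (c a)" "\<And>\<alpha> a b. \<phi> \<alpha> (c a) b = Some a"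
proof -
  have smn: "\<exists>c. computable c \<and> (\<forall>\<alpha> m n. \<phi> \<alpha> (c m) n = peval \<alpha> e [m, n])" for e
    using assms by (auto simp: acceptable_def)
  obtain c where c: "computable c" "\<And>\<alpha> m n. \<phi> \<alpha> (c m) n = peval \<alpha> (Proj 0) [m, n]"
    using smn by blast
  obtain e where e: "\<And>\<alpha> n. peval \<alpha> e [n] = Some (c n)"
    using c(1) by (auto simp: computable_def)
  obtain d where d: "\<And>\<alpha> m n. \<phi> \<alpha> (d m) n = peval \<alpha> (Comp e [Proj 1]) [m, n]"
    using smn by blast
  show thesis by (rule that[of "d 0" c]) (simp_all add: c(2) d e)
qed

lemma acceptable_s:
  assumes "acceptable \<phi>"
  obtains s c d where "\<And>\<alpha> a. \<phi> \<alpha> s a = Some (c a)" "\<And>\<alpha> a b. \<phi> \<alpha> (c a) b = Some (d a b)"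
    "\<And>\<alpha> a b n. \<phi> \<alpha> (d a b) n =
       Option.bind (\<phi> \<alpha> a n) (\<lambda>x. Option.bind (\<phi> \<alpha> b n) (\<lambda>y. \<phi> \<alpha> x y))"
proof -
  have smn: "\<exists>c. computable c \<and> (\<forall>\<alpha> m n. \<phi> \<alpha> (c m) n = peval \<alpha> e [m, n])" for e
    using assms by (auto simp: acceptable_def)
  obtain u where u: "\<And>\<alpha> m n. \<phi> \<alpha> m n = peval \<alpha> u [m, n]"
    using assms by (auto simp: acceptable_def)
  define e where "e = Comp u [Comp u [Comp pFst [Proj 0], Proj 1], Comp u [Comp pSnd [Proj 0], Proj 1]]"
  obtain f where f: "computable f" "\<And>\<alpha> m n. \<phi> \<alpha> (f m) n = peval \<alpha> e [m, n]"
    using smn by blast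
  obtain g where g: "\<And>\<alpha> n. peval \<alpha> g [n] = Some (f n)"
    using f(1) by (auto simp: computable_def)
  obtain c where c: "computable c" "\<And>\<alpha> m n. \<phi> \<alpha> (c m) n = peval \<alpha> (Comp g [pPair]) [m, n]"
    using smn by blast
  obtain h where h: "\<And>\<alpha> n. peval \<alpha> h [n] = Some (c n)"
    using c(1) by (auto simp: computable_def)
  obtain d where d: "\<And>\<alpha> m n. \<phi> \<alpha> (d m) n = peval \<alpha> (Comp h [Proj 1]) [m, n]"
    using smn by blast
  have "\<phi> \<alpha> (f (prod_encode (a, b))) n =
       Option.bind (\<phi> \<alpha> a n) (\<lambda>x. Option.bind (\<phi> \<alpha> b n) (\<lambda>y. \<phi> \<alpha> x y))" for \<alpha> a b n
    unfolding f(2) e_def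
    by (cases "peval \<alpha> u [a, n]"; cases "peval \<alpha> u [b, n]") (simp_all add: peval_pFst peval_pSnd u)
  then show thesis
    by (intro that[of "d 0" c "\<lambda>a b. f (prod_encode (a, b))"]) (simp_all add: c(2) d g h peval_pPair)
qed

theorem ppca_oracle_struct:
  assumes "acceptable \<phi>" and "M \<noteq> {}"
  shows "ppca (oracle_struct \<phi> M)"
proof -
  obtain k c where k: "\<And>\<alpha> a. \<phi> \<alpha> k a = Some (c a)" "\<And>\<alpha> a b. \<phi> \<alpha> (c a) b = Some a"
    using acceptable_k[OF assms(1)] by blast
  obtain s d d' where s: "\<And>\<alpha> a. \<phi> \<alpha> s a = Some (d a)" "\<And>\<alpha> a b. \<phi> \<alpha> (d a) b = Some (d' a b)"
    "\<And>\<alpha> a b n. \<phi> \<alpha> (d' a b) n =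
       Option.bind (\<phi> \<alpha> a n) (\<lambda>x. Option.bind (\<phi> \<alpha> b n) (\<lambda>y. \<phi> \<alpha> x y))"
    using acceptable_s[OF assms(1)] by blast
  have "ks_combinators (oracle_struct \<phi> M) k s"
    by (simp add: ks_combinators_def oracle_struct_def oapp_def k s)
  with assms(2) show ?thesis by (auto simp: ppca_def oracle_struct_def)
qed

lemma bin_real_surj:
  assumes "x \<in> {0..1}"
  shows "\<exists>\<alpha>. bin_real \<alpha> = x"
proof (cases "x = 1")
  case True
  have "(\<lambda>i. (1/2::real) ^ Suc i) sums 1" by (rule power_half_series)
  then have "bin_real (\<lambda>_. True) = 1" by (simp add: bin_real_def sums_iff)
  with True show ?thesis by blast
next
  case False
  with assms have x: "0 \<le> x" "x < 1" by auto
  define f where "f n = of_int \<lfloor>x * 2 ^ n\<rfloor> / (2::real) ^ n" for n :: nat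
  define \<alpha> where "\<alpha> i = odd \<lfloor>x * 2 ^ (i + 1)\<rfloor>" for i :: nat
  have step: "f (Suc n) - f n = of_bool (\<alpha> n) * (1/2) ^ (n + 1)" for n
  proof -
    have fl: "\<lfloor>x * 2 ^ n\<rfloor> = \<lfloor>x * 2 ^ (n + 1)\<rfloor> div 2"
    proof -
      have "\<lfloor>x * 2 ^ n\<rfloor> = \<lfloor>x * 2 ^ (n + 1) / real_of_int 2\<rfloor>" by simp
      also have "\<dots> = \<lfloor>x * 2 ^ (n + 1)\<rfloor> div 2" by (rule floor_divide_real_eq_div) simp
      finally show ?thesis .
    qed
    define z where "z = \<lfloor>x * 2 ^ (n + 1)\<rfloor>"
    have "z = 2 * (z div 2) + of_bool (odd z)" by (simp add: odd_two_times_div_two_succ)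
    then have "real_of_int z = 2 * real_of_int (z div 2) + of_bool (odd z)"
      by (metis of_int_add of_int_mult of_int_numeral of_int_of_bool)
    then show ?thesis
      unfolding f_def \<alpha>_def Suc_eq_plus1 fl z_def[symmetric]
      by (simp add: field_simps)
  qed
  have bnd: "\<bar>f n - x\<bar> \<le> (1/2) ^ n" for n
  proof -
    have "\<bar>of_int \<lfloor>x * 2 ^ n\<rfloor> - x * 2 ^ n\<bar> / 2 ^ n \<le> 1 / 2 ^ n"
      by (intro divide_right_mono) (linarith, simp)
    also have "\<bar>of_int \<lfloor>x * 2 ^ n\<rfloor> - x * 2 ^ n\<bar> / 2 ^ n =
        \<bar>(of_int \<lfloor>x * 2 ^ n\<rfloor> - x * 2 ^ n) / 2 ^ n\<bar>"
      by (simp add: abs_divide)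
    also have "(of_int \<lfloor>x * 2 ^ n\<rfloor> - x * 2 ^ n) / 2 ^ n = f n - x"
      by (simp add: f_def diff_divide_distrib)
    finally show ?thesis by (simp add: power_divide)
  qed
  have "f \<longlonglongrightarrow> x"
  proof (rule LIM_zero_cancel, rule tendsto_rabs_zero_cancel, rule tendsto_sandwich)
    show "\<forall>\<^sub>F n in sequentially. 0 \<le> \<bar>f n - x\<bar>" by simp
    show "\<forall>\<^sub>F n in sequentially. \<bar>f n - x\<bar> \<le> (1/2) ^ n" using bnd by simp
    show "(\<lambda>n. (1/2::real) ^ n) \<longlonglongrightarrow> 0" by (rule LIMSEQ_power_zero) simp
  qed simp
  from telescope_sums[OF this] have "(\<lambda>n. f (Suc n) - f n) sums (x - f 0)" .
  moreover have "f 0 = 0" using x by (simp add: f_def floor_eq_iff)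
  ultimately have "(\<lambda>n. of_bool (\<alpha> n) * (1/2) ^ (n + 1)) sums x" unfolding step by simp
  then show ?thesis unfolding bin_real_def by (metis sums_unique)
qed

lemma seq_oracles_nonempty:
  assumes "computable_pairing pr" and "\<And>n. a n \<in> {0..1}"
  shows "seq_oracles pr a \<noteq> {}"
proof -
  obtain \<beta> where \<beta>: "\<And>n. bin_real (\<beta> n) = a n"
    using bin_real_surj[OF assms(2)] by metis
  define \<alpha> where "\<alpha> z = (case inv (\<lambda>(m, n). pr m n) z of (n, m) \<Rightarrow> \<beta> n m)" for z
  have "inj (\<lambda>(m, n). pr m n)"
    using assms(1) by (simp add: computable_pairing_def bij_is_inj)
  from inv_f_f[OF this] have "inv (\<lambda>(m, n). pr m n) (pr n m) = (n, m)" for n m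
    by (metis case_prod_conv)
  then have "bin_seq pr \<alpha> = a" by (simp add: fun_eq_iff bin_seq_def \<alpha>_def \<beta>)
  then show ?thesis by (auto simp: seq_oracles_def)
qed


section \<open>Intuitionistic reasoning in the tripos\<close>

context
  fixes T :: "('p, 'a) app_struct" (structure)
  assumes T: "ppca T"
begin

lemma params_ne: "params T \<noteq> {}" using T by (simp add: ppca_def)
lemma some_param: "some_param T \<in> params T"
  unfolding some_param_def some_in_eq by (rule params_ne)

lemma ks_ks: "ks_combinators T (cK T) (cS T)"
proof -
  obtain k s where "ks_combinators T k s" using T unfolding ppca_def by blast
  then have "case (k, s) of (k, s) \<Rightarrow> ks_combinators T k s" by simp
  then have "case ks T of (k, s) \<Rightarrow> ks_combinators T k s" unfolding ks_def by (rule someI)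
  then show ?thesis by (simp add: cK_def cS_def split_beta)
qed

lemma ks_all:
  assumes "p \<in> params T"
  shows "app T p (cK T) a = app T (some_param T) (cK T) a \<and>
    oapp T p (app T p (cK T) a) (Some b) = Some a \<and>
    app T p (cS T) a \<noteq> None \<and>
    app T p (cS T) a = app T (some_param T) (cS T) a \<and>
    oapp T p (app T p (cS T) a) (Some b) \<noteq> None \<and>
    oapp T p (app T p (cS T) a) (Some b) =
      oapp T (some_param T) (app T (some_param T) (cS T) a) (Some b) \<and>
    oapp T p (oapp T p (app T p (cS T) a) (Some b)) (Some c) =
      oapp T p (app T p a c) (app T p b c)"
  using ks_ks[unfolded ks_combinators_def, THEN bspec, OF assms, THEN bspec, OF some_param,
      THEN spec, of a, THEN spec, of b, THEN spec, of c] .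

lemmas ksD = ks_all[THEN conjunct1] ks_all[THEN conjunct2, THEN conjunct1]
  ks_all[THEN conjunct2, THEN conjunct2, THEN conjunct1]
  ks_all[THEN conjunct2, THEN conjunct2, THEN conjunct2, THEN conjunct1]
  ks_all[THEN conjunct2, THEN conjunct2, THEN conjunct2, THEN conjunct2, THEN conjunct1]
  ks_all[THEN conjunct2, THEN conjunct2, THEN conjunct2, THEN conjunct2, THEN conjunct2,
    THEN conjunct1]
  ks_all[THEN conjunct2, THEN conjunct2, THEN conjunct2, THEN conjunct2, THEN conjunct2,
    THEN conjunct2]

lemma app_K: assumes "p \<in> params T" shows "app T p (cK T) a = Some (cK1 T a)"
  using ksD(1,2)[OF assms, of a]
  by (cases "app T (some_param T) (cK T) a") (simp_all add: oapp_def cK1_def)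

lemma app_K1: assumes "p \<in> params T" shows "app T p (cK1 T a) b = Some a"
  using ksD(2)[OF assms, of a b] by (simp add: app_K[OF assms] oapp_def)

lemma app_S: assumes "p \<in> params T" shows "app T p (cS T) a = Some (cS1 T a)"
  using ksD(3,4)[OF assms, of a] by (simp add: cS1_def)

lemma app_S1: assumes "p \<in> params T" shows "app T p (cS1 T a) b = Some (cS2 T a b)"
  using ksD(5,6)[OF assms, of a b] by (simp add: cS2_def app_S assms some_param oapp_def)

lemma app_S2:
  assumes "p \<in> params T"
  shows "app T p (cS2 T a b) c = oapp T p (app T p a c) (app T p b c)"
  using ksD(7)[OF assms, of a b c] by (simp add: app_S app_S1 assms oapp_def)

lemma oapp_Some: "oapp T p (Some a) (Some b) = app T p a b" by (simp add: oapp_def)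

lemma app_I: "p \<in> params T \<Longrightarrow> app T p (cI T) a = Some a"
  by (simp add: cI_def app_S2 app_K app_K1 oapp_Some)

lemmas app_simps = app_K app_K1 app_S app_S1 app_S2 app_I oapp_Some

lemma app_pair: "p \<in> params T \<Longrightarrow> app T p (cpair T a b) z = oapp T p (app T p z a) (Some b)"
  by (simp add: cpair_def app_simps)

lemma entailsI:
  assumes "\<And>x b p. b \<in> \<phi> x \<Longrightarrow> p \<in> params T \<Longrightarrow> \<exists>c\<in>\<psi> x. app T p a b = Some c"
  shows "\<phi> \<^bold>\<le> \<psi>"
  using assms unfolding entails_def by blast

lemma ent_refl: "\<phi> \<^bold>\<le> \<phi>"
  by (rule entailsI[of _ _ "cI T"]) (simp add: app_simps)

lemma ent_trans: assumes "\<phi> \<^bold>\<le> \<psi>" "\<psi> \<^bold>\<le> \<chi>" shows "\<phi> \<^bold>\<le> \<chi>"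
proof -
  obtain a where a: "\<And>x b p. b \<in> \<phi> x \<Longrightarrow> p \<in> params T \<Longrightarrow> \<exists>c\<in>\<psi> x. app T p a b = Some c"
    using assms(1) unfolding entails_def by blast
  obtain a' where a': "\<And>x b p. b \<in> \<psi> x \<Longrightarrow> p \<in> params T \<Longrightarrow> \<exists>c\<in>\<chi> x. app T p a' b = Some c"
    using assms(2) unfolding entails_def by blast
  show ?thesis
  proof (rule entailsI[of _ _ "cS2 T (cK1 T a') a"])
    fix x b p assume b: "b \<in> \<phi> x" and p: "p \<in> params T"
    from a[OF this] obtain c where "c \<in> \<psi> x" "app T p a b = Some c" by blast
    with a'[of c x p] p show "\<exists>c\<in>\<chi> x. app T p (cS2 T (cK1 T a') a) b = Some c"
      by (auto simp: app_simps)
  qed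
qed

lemma ent_reindex: "\<phi> \<^bold>\<le> \<psi> \<Longrightarrow> (\<lambda>w. \<phi> (f w)) \<^bold>\<le> (\<lambda>w. \<psi> (f w))"
  unfolding entails_def by blast

lemma ent_top: "\<phi> \<^bold>\<le> (\<lambda>_. UNIV)"
  by (rule entailsI[of _ _ "cI T"]) (simp add: app_simps)

lemma ent_bot: "(\<lambda>_. {}) \<^bold>\<le> \<psi>"
  by (rule entailsI[of _ _ "cI T"]) simp

lemma ent_conjI: assumes "\<chi> \<^bold>\<le> \<phi>" "\<chi> \<^bold>\<le> \<psi>" shows "\<chi> \<^bold>\<le> (\<lambda>x. \<phi> x \<^bold>\<and> \<psi> x)"
proof -
  obtain f where f: "\<And>x b p. b \<in> \<chi> x \<Longrightarrow> p \<in> params T \<Longrightarrow> \<exists>c\<in>\<phi> x. app T p f b = Some c"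
    using assms(1) unfolding entails_def by blast
  obtain g where g: "\<And>x b p. b \<in> \<chi> x \<Longrightarrow> p \<in> params T \<Longrightarrow> \<exists>c\<in>\<psi> x. app T p g b = Some c"
    using assms(2) unfolding entails_def by blast
  let ?K = "cK1 T" and ?S = "cS2 T"
  let ?A = "?S (?S (?K (cS T)) (?K (cI T))) (?S (?K (cK T)) f)"
  let ?B = "?S (?K (cK T)) g"
  have A: "app T p ?A b = Some (?S (cI T) (?K u))"
    if "p \<in> params T" "app T p f b = Some u" for p b u
    using that by (simp add: app_simps)
  show ?thesis
  proof (rule entailsI[of _ _ "?S (?S (?K (cS T)) ?A) ?B"])
    fix x b p assume b: "b \<in> \<chi> x" and p: "p \<in> params T"
    obtain u v where "u \<in> \<phi> x" "app T p f b = Some u" "v \<in> \<psi> x" "app T p g b = Some v"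
      using f[OF b p] g[OF b p] by blast
    with p show "\<exists>c\<in>(\<phi> x \<^bold>\<and> \<psi> x). app T p (?S (?S (?K (cS T)) ?A) ?B) b = Some c"
      by (auto simp: app_simps t_conj_def cpair_def)
  qed
qed

lemma ent_fst: "(\<lambda>x. \<phi> x \<^bold>\<and> \<psi> x) \<^bold>\<le> \<phi>"
  by (rule entailsI[of _ _ "cS2 T (cI T) (cK1 T (cK T))"]) (auto simp: t_conj_def app_simps app_pair)

lemma ent_snd: "(\<lambda>x. \<phi> x \<^bold>\<and> \<psi> x) \<^bold>\<le> \<psi>"
  by (rule entailsI[of _ _ "cS2 T (cI T) (cK1 T (cfalse T))"])
    (auto simp: t_conj_def app_simps app_pair cfalse_def)

lemma ent_impI: assumes "(\<lambda>x. \<phi> x \<^bold>\<and> \<psi> x) \<^bold>\<le> \<chi>" shows "\<phi> \<^bold>\<le> (\<lambda>x. \<psi> x \<^bold>\<longrightarrow> \<chi> x)"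
proof -
  obtain h where h: "\<And>x b p. b \<in> (\<phi> x \<^bold>\<and> \<psi> x) \<Longrightarrow> p \<in> params T \<Longrightarrow> \<exists>c\<in>\<chi> x. app T p h b = Some c"
    using assms unfolding entails_def by blast
  let ?K = "cK1 T" and ?S = "cS2 T"
  let ?Q = "?S (?K (cS T)) (?S (?K (cS1 T (cI T))) (cK T))"
  let ?e = "?S (?K (cS1 T (?K h))) (?S (?S (?K (cS T)) (?S (?K (cK T)) ?Q)) (?K (cK T)))"
  show ?thesis
  proof (rule entailsI[of _ _ ?e])
    fix x b p assume b: "b \<in> \<phi> x" and p: "p \<in> params T"
    let ?c = "?S (?K h) (?S (?K (cS1 T (?S (cI T) (?K b)))) (cK T))"
    have "app T p ?e b = Some ?c" using p by (simp add: app_simps)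
    moreover have "?c \<in> (\<psi> x \<^bold>\<longrightarrow> \<chi> x)"
    proof -
      have "\<exists>c\<in>\<chi> x. app T r ?c d = Some c" if d: "d \<in> \<psi> x" and r: "r \<in> params T" for d r
      proof -
        have "app T r ?c d = app T r h (cpair T b d)"
          using r by (simp add: app_simps cpair_def)
        moreover have "cpair T b d \<in> (\<phi> x \<^bold>\<and> \<psi> x)" using b d by (auto simp: t_conj_def)
        ultimately show ?thesis using h[OF _ r] by simp
      qed
      then show ?thesis by (simp add: t_imp_def)
    qed
    ultimately show "\<exists>c\<in>(\<psi> x \<^bold>\<longrightarrow> \<chi> x). app T p ?e b = Some c" by blast
  qed
qed

lemma ent_mp: assumes "\<phi> \<^bold>\<le> (\<lambda>x. \<psi> x \<^bold>\<longrightarrow> \<chi> x)" "\<phi> \<^bold>\<le> \<psi>" shows "\<phi> \<^bold>\<le> \<chi>"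
proof -
  obtain f where f: "\<And>x b p. b \<in> \<phi> x \<Longrightarrow> p \<in> params T \<Longrightarrow>
      \<exists>c\<in>(\<psi> x \<^bold>\<longrightarrow> \<chi> x). app T p f b = Some c"
    using assms(1) unfolding entails_def by blast
  obtain g where g: "\<And>x b p. b \<in> \<phi> x \<Longrightarrow> p \<in> params T \<Longrightarrow> \<exists>c\<in>\<psi> x. app T p g b = Some c"
    using assms(2) unfolding entails_def by blast
  show ?thesis
  proof (rule entailsI[of _ _ "cS2 T f g"])
    fix x b p assume b: "b \<in> \<phi> x" and p: "p \<in> params T"
    from f[OF b p] g[OF b p] p show "\<exists>c\<in>\<chi> x. app T p (cS2 T f g) b = Some c"
      by (auto simp: app_simps t_imp_def)
  qed
qed

lemma ent_allI:
  assumes "(\<lambda>(x, y). \<phi> x) \<^bold>\<le> (\<lambda>(x, y). \<psi> x y)" shows "\<phi> \<^bold>\<le> (\<lambda>x. \<^bold>\<forall> (\<psi> x))"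
proof -
  obtain g where "\<forall>z. \<forall>b\<in>(case z of (x, y) \<Rightarrow> \<phi> x). \<forall>p\<in>params T.
      \<exists>c\<in>(case z of (x, y) \<Rightarrow> \<psi> x y). app T p g b = Some c"
    using assms unfolding entails_def by (rule exE)
  then have g: "\<exists>c\<in>\<psi> x y. app T p g b = Some c" if "b \<in> \<phi> x" "p \<in> params T" for x y b p
    using that by (metis case_prod_conv)
  show ?thesis
  proof (rule entailsI[of _ _ "cS2 T (cK1 T (cS1 T (cK1 T g))) (cK T)"])
    fix x b p assume "b \<in> \<phi> x" and "p \<in> params T"
    then show "\<exists>c\<in>\<^bold>\<forall> (\<psi> x). app T p (cS2 T (cK1 T (cS1 T (cK1 T g))) (cK T)) b = Some c"
      using g by (auto simp: app_simps t_All_def t_all_along_def)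
  qed
qed

lemma ent_allE: assumes "\<phi> \<^bold>\<le> (\<lambda>x. \<^bold>\<forall> (\<psi> x))" shows "\<phi> \<^bold>\<le> (\<lambda>x. \<psi> x (t x))"
proof (rule ent_trans[OF assms])
  show "(\<lambda>x. \<^bold>\<forall> (\<psi> x)) \<^bold>\<le> (\<lambda>x. \<psi> x (t x))"
    by (rule entailsI[of _ _ "cS2 T (cI T) (cK1 T (cI T))"])
      (auto simp: app_simps t_All_def t_all_along_def)
qed

lemma t_Ex_eq: "t_Ex \<phi> = (\<Union>y. \<phi> y)" by (simp add: t_Ex_def t_ex_along_def)

lemma ent_exI: assumes "\<phi> \<^bold>\<le> (\<lambda>x. \<psi> x (t x))" shows "\<phi> \<^bold>\<le> (\<lambda>x. t_Ex (\<psi> x))"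
proof -
  obtain a where a: "\<And>x b p. b \<in> \<phi> x \<Longrightarrow> p \<in> params T \<Longrightarrow>
      \<exists>c\<in>\<psi> x (t x). app T p a b = Some c"
    using assms unfolding entails_def by blast
  show ?thesis
    by (rule entailsI[of _ _ a], drule (1) a) (auto simp: t_Ex_eq)
qed

lemma ent_exE':
  assumes "(\<lambda>(x, y). \<psi> x y) \<^bold>\<le> (\<lambda>(x, y). \<chi> x)" shows "(\<lambda>x. t_Ex (\<psi> x)) \<^bold>\<le> \<chi>"
proof -
  obtain g where "\<forall>z. \<forall>b\<in>(case z of (x, y) \<Rightarrow> \<psi> x y). \<forall>p\<in>params T.
      \<exists>c\<in>(case z of (x, y) \<Rightarrow> \<chi> x). app T p g b = Some c"
    using assms unfolding entails_def by (rule exE)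
  then have g: "\<exists>c\<in>\<chi> x. app T p g b = Some c" if "b \<in> \<psi> x y" "p \<in> params T" for x y b p
    using that by (metis case_prod_conv)
  show ?thesis
    by (rule entailsI[of _ _ g]) (auto simp: t_Ex_eq intro: g)
qed

lemma ent_disjI1: assumes "\<chi> \<^bold>\<le> \<phi>" shows "\<chi> \<^bold>\<le> (\<lambda>x. \<phi> x \<^bold>\<or> \<psi> x)"
proof -
  let ?e = "cS2 T (cK1 T (cS1 T (cS2 T (cI T) (cK1 T (ctrue T))))) (cK T)"
  have "\<phi> \<^bold>\<le> (\<lambda>x. \<phi> x \<^bold>\<or> \<psi> x)"
    by (rule entailsI[of _ _ ?e]) (auto simp: app_simps t_disj_def cpair_def)
  then show ?thesis by (rule ent_trans[OF assms])
qed

lemma ent_disjI2: assumes "\<chi> \<^bold>\<le> \<psi>" shows "\<chi> \<^bold>\<le> (\<lambda>x. \<phi> x \<^bold>\<or> \<psi> x)"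
proof -
  let ?e = "cS2 T (cK1 T (cS1 T (cS2 T (cI T) (cK1 T (cfalse T))))) (cK T)"
  have "\<psi> \<^bold>\<le> (\<lambda>x. \<phi> x \<^bold>\<or> \<psi> x)"
    by (rule entailsI[of _ _ ?e]) (auto simp: app_simps t_disj_def cpair_def)
  then show ?thesis by (rule ent_trans[OF assms])
qed

lemma ent_disjE': assumes "\<phi> \<^bold>\<le> \<chi>" "\<psi> \<^bold>\<le> \<chi>" shows "(\<lambda>x. \<phi> x \<^bold>\<or> \<psi> x) \<^bold>\<le> \<chi>"
proof -
  obtain f where f: "\<And>x b p. b \<in> \<phi> x \<Longrightarrow> p \<in> params T \<Longrightarrow> \<exists>c\<in>\<chi> x. app T p f b = Some c"
    using assms(1) unfolding entails_def by blast
  obtain g where g: "\<And>x b p. b \<in> \<psi> x \<Longrightarrow> p \<in> params T \<Longrightarrow> \<exists>c\<in>\<chi> x. app T p g b = Some c"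
    using assms(2) unfolding entails_def by blast
  let ?fst = "cS2 T (cI T) (cK1 T (cK T))"
  let ?snd = "cS2 T (cI T) (cK1 T (cfalse T))"
  show ?thesis
    by (rule entailsI[of _ _ "cS2 T (cS2 T (cS2 T ?fst (cK1 T f)) (cK1 T g)) ?snd"])
      (use f g in \<open>auto simp: t_disj_def app_simps app_pair ctrue_def cfalse_def\<close>)
qed

lemma validI: assumes "(\<lambda>_ :: unit. UNIV) \<^bold>\<le> (\<lambda>_. U)" shows "\<^bold>\<turnstile> U"
  using assms by (simp add: valid_def)

lemma ent_conjD1: "\<chi> \<^bold>\<le> (\<lambda>x. \<phi> x \<^bold>\<and> \<psi> x) \<Longrightarrow> \<chi> \<^bold>\<le> \<phi>" using ent_trans ent_fst by blast
lemma ent_conjD2: "\<chi> \<^bold>\<le> (\<lambda>x. \<phi> x \<^bold>\<and> \<psi> x) \<Longrightarrow> \<chi> \<^bold>\<le> \<psi>" using ent_trans ent_snd by blast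

lemma ent_impD: assumes "\<chi> \<^bold>\<le> (\<lambda>x. \<phi> x \<^bold>\<longrightarrow> \<psi> x)" shows "(\<lambda>x. \<chi> x \<^bold>\<and> \<phi> x) \<^bold>\<le> \<psi>"
  by (rule ent_mp[OF ent_trans[OF ent_fst assms] ent_snd])

lemma ent_app: "\<chi> \<^bold>\<le> (\<lambda>x. \<phi> x \<^bold>\<longrightarrow> \<psi> x) \<Longrightarrow> \<theta> \<^bold>\<le> \<chi> \<Longrightarrow> \<theta> \<^bold>\<le> \<phi> \<Longrightarrow> \<theta> \<^bold>\<le> \<psi>"
  using ent_mp ent_trans by blast

lemma ent_cong_refl: "\<chi> \<^bold>\<le> (\<lambda>x. \<phi> x \<^bold>\<longrightarrow> \<phi> x)"
  by (rule ent_impI[OF ent_snd])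

lemma ent_cong_conj:
  assumes "\<chi> \<^bold>\<le> (\<lambda>x. \<phi> x \<^bold>\<longrightarrow> \<phi>' x)" "\<chi> \<^bold>\<le> (\<lambda>x. \<psi> x \<^bold>\<longrightarrow> \<psi>' x)"
  shows "\<chi> \<^bold>\<le> (\<lambda>x. (\<phi> x \<^bold>\<and> \<psi> x) \<^bold>\<longrightarrow> (\<phi>' x \<^bold>\<and> \<psi>' x))"
  by (rule ent_impI, rule ent_conjI)
    (rule ent_app[OF assms(1) ent_fst ent_conjD1[OF ent_snd]],
     rule ent_app[OF assms(2) ent_fst ent_conjD2[OF ent_snd]])

lemma ent_cong_imp:
  assumes "\<chi> \<^bold>\<le> (\<lambda>x. \<phi>' x \<^bold>\<longrightarrow> \<phi> x)" "\<chi> \<^bold>\<le> (\<lambda>x. \<psi> x \<^bold>\<longrightarrow> \<psi>' x)"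
  shows "\<chi> \<^bold>\<le> (\<lambda>x. (\<phi> x \<^bold>\<longrightarrow> \<psi> x) \<^bold>\<longrightarrow> (\<phi>' x \<^bold>\<longrightarrow> \<psi>' x))"
  by (rule ent_impI, rule ent_impI, rule ent_app[OF assms(2) ent_trans[OF ent_fst ent_fst]],
      rule ent_mp[OF ent_trans[OF ent_fst ent_snd]], rule ent_app[OF assms(1) ent_trans[OF ent_fst ent_fst] ent_snd])

lemma ent_imp_swap: assumes "\<phi> \<^bold>\<le> (\<lambda>x. \<chi> x \<^bold>\<longrightarrow> \<psi> x)" shows "\<chi> \<^bold>\<le> (\<lambda>x. \<phi> x \<^bold>\<longrightarrow> \<psi> x)"
  by (rule ent_impI, rule ent_app[OF assms ent_snd ent_fst])

lemma ent_cong_disj: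
  assumes "\<chi> \<^bold>\<le> (\<lambda>x. \<phi> x \<^bold>\<longrightarrow> \<phi>' x)" "\<chi> \<^bold>\<le> (\<lambda>x. \<psi> x \<^bold>\<longrightarrow> \<psi>' x)"
  shows "\<chi> \<^bold>\<le> (\<lambda>x. (\<phi> x \<^bold>\<or> \<psi> x) \<^bold>\<longrightarrow> (\<phi>' x \<^bold>\<or> \<psi>' x))"
  by (rule ent_imp_swap, rule ent_disjE'; rule ent_imp_swap, rule ent_impI)
    (rule ent_disjI1, rule ent_impD[OF assms(1)],
     rule ent_disjI2, rule ent_impD[OF assms(2)])

lemma ent_cong_not:
  assumes "\<chi> \<^bold>\<le> (\<lambda>x. \<phi>' x \<^bold>\<longrightarrow> \<phi> x)"
  shows "\<chi> \<^bold>\<le> (\<lambda>x. (\<^bold>\<not> \<phi> x) \<^bold>\<longrightarrow> (\<^bold>\<not> \<phi>' x))"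
  unfolding t_not_def by (rule ent_cong_imp[OF assms ent_cong_refl])

lemma ent_cong_iff:
  assumes "\<chi> \<^bold>\<le> (\<lambda>x. \<phi> x \<^bold>\<longrightarrow> \<phi>' x)" "\<chi> \<^bold>\<le> (\<lambda>x. \<psi> x \<^bold>\<longrightarrow> \<psi>' x)"
    "\<chi> \<^bold>\<le> (\<lambda>x. \<phi>' x \<^bold>\<longrightarrow> \<phi> x)" "\<chi> \<^bold>\<le> (\<lambda>x. \<psi>' x \<^bold>\<longrightarrow> \<psi> x)"
  shows "\<chi> \<^bold>\<le> (\<lambda>x. (\<phi> x \<^bold>\<longleftrightarrow> \<psi> x) \<^bold>\<longrightarrow> (\<phi>' x \<^bold>\<longleftrightarrow> \<psi>' x))"
  unfolding t_iff_def by (intro ent_cong_conj ent_cong_imp assms)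

lemma ent_cong_all:
  assumes "(\<lambda>z. \<chi> (fst z)) \<^bold>\<le> (\<lambda>z. \<phi> (fst z) (snd z) \<^bold>\<longrightarrow> \<psi> (fst z) (snd z))"
  shows "\<chi> \<^bold>\<le> (\<lambda>x. \<^bold>\<forall> (\<lambda>y. \<phi> x y) \<^bold>\<longrightarrow> \<^bold>\<forall> (\<lambda>y. \<psi> x y))"
proof (rule ent_impI, rule ent_allI, unfold split_beta)
  let ?C = "\<lambda>z. \<chi> (fst z) \<^bold>\<and> \<^bold>\<forall> (\<lambda>y. \<phi> (fst z) y)"
  show "?C \<^bold>\<le> (\<lambda>z. \<psi> (fst z) (snd z))"
    by (rule ent_app[OF assms ent_fst], rule ent_allE[of ?C "\<lambda>z. \<phi> (fst z)" snd], rule ent_snd)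
qed

lemma ent_cong_ex:
  assumes "(\<lambda>z. \<chi> (fst z)) \<^bold>\<le> (\<lambda>z. \<phi> (fst z) (snd z) \<^bold>\<longrightarrow> \<psi> (fst z) (snd z))"
  shows "\<chi> \<^bold>\<le> (\<lambda>x. t_Ex (\<lambda>y. \<phi> x y) \<^bold>\<longrightarrow> t_Ex (\<lambda>y. \<psi> x y))"
proof (rule ent_imp_swap, rule ent_exE', unfold split_beta, rule ent_imp_swap, rule ent_impI)
  let ?C = "\<lambda>z. \<chi> (fst z) \<^bold>\<and> \<phi> (fst z) (snd z)"
  show "?C \<^bold>\<le> (\<lambda>z. t_Ex (\<lambda>y. \<psi> (fst z) y))"
    by (rule ent_exI[of ?C "\<lambda>z. \<psi> (fst z)" snd], rule ent_impD[OF assms])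
qed

lemma topos_objectI:
  assumes "(\<lambda>(x, y). E x y) \<^bold>\<le> (\<lambda>(x, y). E y x)"
    and "(\<lambda>(x, y, z). E x y \<^bold>\<and> E y z) \<^bold>\<le> (\<lambda>(x, y, z). E x z)"
  shows "topos_object T E"
  unfolding topos_object_def
proof
  have "(\<lambda>z. UNIV) \<^bold>\<le> (\<lambda>z. E (snd (fst z)) (snd z) \<^bold>\<longrightarrow> E (snd z) (snd (fst z)))"
    by (rule ent_impI, rule ent_trans[OF ent_snd])
      (use ent_reindex[OF assms(1), of "\<lambda>z. (snd (fst z), snd z)"] in simp)
  then show "\<^bold>\<turnstile> \<^bold>\<forall> (\<lambda>x. \<^bold>\<forall> (\<lambda>y. E x y \<^bold>\<longrightarrow> E y x))"
    by - (rule validI, rule ent_allI, unfold split_beta, rule ent_allI,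
        unfold split_beta, assumption)
  have "(\<lambda>z. UNIV) \<^bold>\<le> (\<lambda>z. E (snd (fst (fst z))) (snd (fst z)) \<^bold>\<and> E (snd (fst z)) (snd z)
      \<^bold>\<longrightarrow> E (snd (fst (fst z))) (snd z))"
    by (rule ent_impI, rule ent_trans[OF ent_snd])
      (use ent_reindex[OF assms(2), of "\<lambda>z. (snd (fst (fst z)), snd (fst z), snd z)"] in simp)
  then show "\<^bold>\<turnstile> \<^bold>\<forall> (\<lambda>x. \<^bold>\<forall> (\<lambda>y. \<^bold>\<forall> (\<lambda>z. E x y \<^bold>\<and> E y z \<^bold>\<longrightarrow> E x z)))"
    by - (rule validI, rule ent_allI, unfold split_beta, rule ent_allI,
        unfold split_beta, rule ent_allI, unfold split_beta, assumption)
qed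

lemma power_fwd:
  assumes "\<chi> \<^bold>\<le> (\<lambda>w. power_object T E (R w) (S w))"
  shows "(\<lambda>z. \<chi> (f z)) \<^bold>\<le> (\<lambda>z. R (f z) (g z) \<^bold>\<longrightarrow> S (f z) (g z))"
proof -
  have "\<chi> \<^bold>\<le> (\<lambda>w. \<^bold>\<forall> (\<lambda>x. R w x \<^bold>\<longleftrightarrow> S w x))"
    using ent_conjD2[OF ent_conjD2[OF assms[unfolded power_object_def]]] .
  from ent_allE[OF ent_reindex[OF this, of f], of g] show ?thesis
    unfolding t_iff_def by (rule ent_conjD1)
qed

lemma power_bwd:
  assumes "\<chi> \<^bold>\<le> (\<lambda>w. power_object T E (R w) (S w))"
  shows "(\<lambda>z. \<chi> (f z)) \<^bold>\<le> (\<lambda>z. S (f z) (g z) \<^bold>\<longrightarrow> R (f z) (g z))"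
proof -
  have "\<chi> \<^bold>\<le> (\<lambda>w. \<^bold>\<forall> (\<lambda>x. R w x \<^bold>\<longleftrightarrow> S w x))"
    using ent_conjD2[OF ent_conjD2[OF assms[unfolded power_object_def]]] .
  from ent_allE[OF ent_reindex[OF this, of f], of g] show ?thesis
    unfolding t_iff_def by (rule ent_conjD2)
qed

lemma ent_imp_trans:
  assumes "\<chi> \<^bold>\<le> (\<lambda>x. \<phi> x \<^bold>\<longrightarrow> \<psi> x)" "\<chi> \<^bold>\<le> (\<lambda>x. \<psi> x \<^bold>\<longrightarrow> \<theta> x)"
  shows "\<chi> \<^bold>\<le> (\<lambda>x. \<phi> x \<^bold>\<longrightarrow> \<theta> x)"
  by (rule ent_impI, rule ent_app[OF assms(2) ent_fst], rule ent_impD[OF assms(1)])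

lemma power_sym:
  assumes H: "\<chi> \<^bold>\<le> (\<lambda>w. power_object T E (R w) (S w))"
  shows "\<chi> \<^bold>\<le> (\<lambda>w. power_object T E (S w) (R w))"
proof -
  note fwd = power_fwd[OF H] and bwd = power_bwd[OF H]
  have "\<chi> \<^bold>\<le> (\<lambda>w. t_strict T E (R w) \<^bold>\<longrightarrow> t_strict T E (S w))"
    unfolding t_strict_def by (rule ent_cong_all, rule ent_cong_imp, rule bwd, rule ent_cong_refl)
  from ent_mp[OF this ent_conjD1[OF H[unfolded power_object_def]]]
  have 1: "\<chi> \<^bold>\<le> (\<lambda>w. t_strict T E (S w))" .
  have "\<chi> \<^bold>\<le> (\<lambda>w. t_extensional T E (R w) \<^bold>\<longrightarrow> t_extensional T E (S w))"
    unfolding t_extensional_def by (rule ent_cong_all, rule ent_cong_all, rule ent_cong_imp, rule ent_cong_conj, rule bwd, rule ent_cong_refl, rule fwd)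
  from ent_mp[OF this ent_conjD1[OF ent_conjD2[OF H[unfolded power_object_def]]]]
  have 2: "\<chi> \<^bold>\<le> (\<lambda>w. t_extensional T E (S w))" .
  have 3: "\<chi> \<^bold>\<le> (\<lambda>w. \<^bold>\<forall> (\<lambda>x. S w x \<^bold>\<longleftrightarrow> R w x))"
    unfolding t_iff_def by (rule ent_allI, unfold split_beta, rule ent_conjI, rule bwd, rule fwd)
  show ?thesis unfolding power_object_def by (rule ent_conjI[OF 1 ent_conjI[OF 2 3]])
qed

lemma power_trans:
  assumes H: "\<chi> \<^bold>\<le> (\<lambda>w. power_object T E (Q w) (R w))" "\<chi> \<^bold>\<le> (\<lambda>w. power_object T E (R w) (S w))"
  shows "\<chi> \<^bold>\<le> (\<lambda>w. power_object T E (Q w) (S w))"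
proof -
  note fwd = power_fwd[OF H(1)] power_fwd[OF H(2)] and bwd = power_bwd[OF H(1)] power_bwd[OF H(2)]
  have "\<chi> \<^bold>\<le> (\<lambda>w. \<^bold>\<forall> (\<lambda>x. Q w x \<^bold>\<longleftrightarrow> S w x))"
    unfolding t_iff_def
    by (rule ent_allI, unfold split_beta, rule ent_conjI,
        rule ent_imp_trans, rule fwd(1), rule fwd(2), rule ent_imp_trans, rule bwd(2), rule bwd(1))
  note 1 = H(1)[unfolded power_object_def] and 2 = this
  show ?thesis
    unfolding power_object_def
    by (rule ent_conjI[OF ent_conjD1[OF 1] ent_conjI[OF ent_conjD1[OF ent_conjD2[OF 1]] 2]])
qed

theorem topos_object_power: "topos_object T (power_object T E)"
proof (rule topos_objectI, unfold split_beta)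
  show "(\<lambda>z. power_object T E (fst z) (snd z)) \<^bold>\<le> (\<lambda>z. power_object T E (snd z) (fst z))"
    by (rule power_sym[OF ent_refl])
  show "(\<lambda>z. power_object T E (fst z) (fst (snd z)) \<^bold>\<and> power_object T E (fst (snd z)) (snd (snd z)))
    \<^bold>\<le> (\<lambda>z. power_object T E (fst z) (snd (snd z)))"
    by (rule power_trans[OF ent_fst ent_snd])
qed

end


theorem topos_object_rat:
  assumes "ppca T" shows "topos_object T (rat_object q)"
proof (rule topos_objectI[OF assms])
  show "entails T (\<lambda>(x, y). rat_object q x y) (\<lambda>(x, y). rat_object q y x)"
    by (rule entailsI[OF assms, where a = "cI T"]) (auto simp: rat_object_def app_I[OF assms])
  show "entails T (\<lambda>(x, y, z). t_conj T (rat_object q x y) (rat_object q y z))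
      (\<lambda>(x, y, z). rat_object q x z)"
    by (rule entailsI[OF assms, where a = "cS2 T (cI T) (cK1 T (cK T))"])
      (auto simp: rat_object_def t_conj_def app_simps[OF assms] app_pair[OF assms])
qed

context
  fixes T :: "('p, nat) app_struct" (structure) and q :: "nat \<Rightarrow> rat"
  assumes T: "ppca T"
begin

lemma reals_fwd:
  assumes "\<chi> \<^bold>\<le> (\<lambda>w. dedekind_reals T q (x w) (y w))"
  shows "\<chi> \<^bold>\<le> (\<lambda>w. power_object T (rat_object q) (fst (x w)) (fst (y w)))"
    "\<chi> \<^bold>\<le> (\<lambda>w. power_object T (rat_object q) (snd (x w)) (snd (y w)))"
    "\<chi> \<^bold>\<le> (\<lambda>w. dedekind_cut T q (x w))"
proof -
  note H = assms[unfolded dedekind_reals_def]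
  show "\<chi> \<^bold>\<le> (\<lambda>w. power_object T (rat_object q) (fst (x w)) (fst (y w)))"
    by (rule ent_conjD1[OF T H])
  show "\<chi> \<^bold>\<le> (\<lambda>w. power_object T (rat_object q) (snd (x w)) (snd (y w)))"
    by (rule ent_conjD1[OF T ent_conjD2[OF T H]])
  show "\<chi> \<^bold>\<le> (\<lambda>w. dedekind_cut T q (x w))"
    by (rule ent_conjD2[OF T ent_conjD2[OF T H]])
qed

lemma reals_cut:
  assumes "\<chi> \<^bold>\<le> (\<lambda>w. dedekind_reals T q (x w) (y w))"
  shows "\<chi> \<^bold>\<le> (\<lambda>w. dedekind_cut T q (y w))"
proof (rule ent_mp[OF T _ reals_fwd(3)[OF assms]])
  note L = power_fwd[OF T reals_fwd(1)[OF assms]] power_bwd[OF T reals_fwd(1)[OF assms]]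
  note U = power_fwd[OF T reals_fwd(2)[OF assms]] power_bwd[OF T reals_fwd(2)[OF assms]]
  note conj = ent_cong_conj[OF T] and disj = ent_cong_disj[OF T] and imp = ent_cong_imp[OF T]
    and iff = ent_cong_iff[OF T] and neg = ent_cong_not[OF T] and all = ent_cong_all[OF T]
    and ex = ent_cong_ex[OF T] and same = ent_cong_refl[OF T]
  show "\<chi> \<^bold>\<le> (\<lambda>w. dedekind_cut T q (x w) \<^bold>\<longrightarrow> dedekind_cut T q (y w))"
    unfolding dedekind_cut_def split_beta rat_all_def rat_ex_def all_in_def ex_in_def
    by (rule conj, rule ex, rule conj, rule same, rule L, rule conj, rule ex, rule conj,
        rule same, rule U, rule conj, rule all, rule imp, rule same, rule iff, rule L,
        rule ex, rule conj, rule same, rule conj, rule same, rule L, rule L, rule ex,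
        rule conj, rule same, rule conj, rule same, rule L, rule conj, rule all, rule
        imp, rule same, rule iff, rule U, rule ex, rule conj, rule same, rule conj, rule
        same, rule U, rule U, rule ex, rule conj, rule same, rule conj, rule same, rule
        U, rule conj, rule all, rule imp, rule same, rule neg, rule conj, rule L, rule
        U, rule all, rule imp, rule same, rule all, rule imp, rule same, rule imp, rule
        same, rule disj, rule L, rule U)
qed

theorem topos_object_dedekind_reals: "topos_object T (dedekind_reals T q)"
proof (rule topos_objectI[OF T], unfold split_beta)
  note r = ent_refl[OF T, of "\<lambda>z. dedekind_reals T q (fst z) (snd z)"]
  show "(\<lambda>z. dedekind_reals T q (fst z) (snd z)) \<^bold>\<le> (\<lambda>z. dedekind_reals T q (snd z) (fst z))"
    unfolding dedekind_reals_def[of T q "snd z" for z]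
    by (rule ent_conjI[OF T power_sym[OF T reals_fwd(1)[OF r]]
          ent_conjI[OF T power_sym[OF T reals_fwd(2)[OF r]] reals_cut[OF r]]])
  note a = ent_fst[OF T, of "\<lambda>z. dedekind_reals T q (fst z) (fst (snd z))"
      "\<lambda>z. dedekind_reals T q (fst (snd z)) (snd (snd z))"]
  note b = ent_snd[OF T, of "\<lambda>z. dedekind_reals T q (fst z) (fst (snd z))"
      "\<lambda>z. dedekind_reals T q (fst (snd z)) (snd (snd z))"]
  show "(\<lambda>z. dedekind_reals T q (fst z) (fst (snd z)) \<^bold>\<and>
      dedekind_reals T q (fst (snd z)) (snd (snd z)))
    \<^bold>\<le> (\<lambda>z. dedekind_reals T q (fst z) (snd (snd z)))"
    unfolding dedekind_reals_def[of T q "fst z" "snd (snd z)" for z]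
    by (rule ent_conjI[OF T power_trans[OF T reals_fwd(1)[OF a] reals_fwd(1)[OF b]]
          ent_conjI[OF T power_trans[OF T reals_fwd(2)[OF a] reals_fwd(2)[OF b]] reals_fwd(3)[OF a]]])
qed

end

end

theory Submission
  imports Defs
begin

text \<open>A realizer \<open>e\<close> of a real \<open>x\<close> decides, by locatedness, between \<open>a < x\<close> and \<open>x < b\<close> for
  rationals \<open>a < b\<close>. The answers depend on the oracle, but approximations of \<open>x\<close> computed from
  them represent the same real for every oracle. So the truncation \<open>y\<close> of \<open>x + 1/2\<close> to the unit
  interval has a \<open>\<mu>\<close>-index computable from \<open>e\<close> alone, and \<open>y\<close> is the entry of \<open>\<mu>\<close> at this index.
  The oracle contains a binary expansion of this entry. Its first digit separates \<open>y \<ge> 1/2\<close> from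
  \<open>y \<le> 1/2\<close>, that is \<open>x \<ge> 0\<close> from \<open>x \<le> 0\<close>. Once the sign is known, locatedness between a
  rational and \<open>0\<close> has only one possible answer, and this realizes the inequality of cuts.\<close>

section \<open>Programs with oracle\<close>

text \<open>One program serves every oracle, which makes the indices built from it independent of
  the oracle. Fixing the length of the argument list lets \<open>F\<close> be written with
  \<open>xs ! i\<close>.\<close>

definition rec_in :: "nat \<Rightarrow> ((nat \<Rightarrow> bool) \<Rightarrow> nat list \<Rightarrow> nat option) \<Rightarrow> bool" where
  "rec_in k F \<longleftrightarrow> (\<exists>e. \<forall>\<alpha> xs. length xs = k \<longrightarrow> peval \<alpha> e xs = F \<alpha> xs)"

abbreviation total_rec :: "nat \<Rightarrow> (nat list \<Rightarrow> nat) \<Rightarrow> bool" where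
  "total_rec k f \<equiv> rec_in k (\<lambda>\<alpha> xs. Some (f xs))"

abbreviation decidable :: "nat \<Rightarrow> (nat list \<Rightarrow> bool) \<Rightarrow> bool" where
  "decidable k P \<equiv> total_rec k (\<lambda>xs. of_bool (P xs))"

lemma total_rec_nth: "i < k \<Longrightarrow> total_rec k (\<lambda>xs. xs ! i)"
  unfolding rec_in_def by (rule exI[of _ "Proj i"]) simp

lemma total_rec_const: "total_rec k (\<lambda>_. c)"
proof (induction c)
  case 0
  show ?case unfolding rec_in_def by (rule exI[of _ Zero]) simp
next
  case (Suc c)
  then obtain e where "\<And>\<alpha> xs. length xs = k \<Longrightarrow> peval \<alpha> e xs = Some c"
    unfolding rec_in_def by blast
  then show ?case unfolding rec_in_def by (intro exI[of _ "Comp Succ [e]"]) simp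
qed

text \<open>\<open>Comp\<close> is strict in its arguments, just as \<open>Option.bind\<close> is.
  Since \<open>h\<close> may depend on \<alpha>, the outer program may itself query the
  oracle.\<close>

lemma rec_in_comp1:
  assumes "\<And>\<alpha> x. peval \<alpha> e [x] = h \<alpha> x" and "rec_in k F"
  shows "rec_in k (\<lambda>\<alpha> xs. Option.bind (F \<alpha> xs) (h \<alpha>))"
proof -
  obtain f where "\<And>\<alpha> xs. length xs = k \<Longrightarrow> peval \<alpha> f xs = F \<alpha> xs"
    using assms(2) unfolding rec_in_def by blast
  then have "peval \<alpha> (Comp e [f]) xs = Option.bind (F \<alpha> xs) (h \<alpha>)" if "length xs = k" for \<alpha> xs
    using that by (cases "F \<alpha> xs") (simp_all add: assms(1))
  then show ?thesis unfolding rec_in_def by blast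
qed

lemma rec_in_comp2:
  assumes "\<And>\<alpha> x y. peval \<alpha> e [x, y] = h \<alpha> x y" and "rec_in k F" "rec_in k G"
  shows "rec_in k (\<lambda>\<alpha> xs. Option.bind (F \<alpha> xs) (\<lambda>x. Option.bind (G \<alpha> xs) (h \<alpha> x)))"
proof -
  obtain f where f: "\<And>\<alpha> xs. length xs = k \<Longrightarrow> peval \<alpha> f xs = F \<alpha> xs"
    using assms(2) unfolding rec_in_def by blast
  obtain g where g: "\<And>\<alpha> xs. length xs = k \<Longrightarrow> peval \<alpha> g xs = G \<alpha> xs"
    using assms(3) unfolding rec_in_def by blast
  have "peval \<alpha> (Comp e [f, g]) xs = Option.bind (F \<alpha> xs) (\<lambda>x. Option.bind (G \<alpha> xs) (h \<alpha> x))"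
    if "length xs = k" for \<alpha> xs
    using that f g by (cases "F \<alpha> xs"; cases "G \<alpha> xs") (simp_all add: assms(1))
  then show ?thesis unfolding rec_in_def by blast
qed

lemma total_rec_computable:
  assumes "computable h" and "total_rec k f"
  shows "total_rec k (\<lambda>xs. h (f xs))"
proof -
  obtain e where "\<And>\<alpha> x. peval \<alpha> e [x] = Some (h x)"
    using assms(1) unfolding computable_def by blast
  from rec_in_comp1[OF this assms(2)] show ?thesis by simp
qed

lemma total_rec_computable2:
  assumes "computable2 h" and "total_rec k f" "total_rec k g"
  shows "total_rec k (\<lambda>xs. h (f xs) (g xs))"
proof -
  obtain e where "\<And>\<alpha> x y. peval \<alpha> e [x, y] = Some (h x y)"
    using assms(1) unfolding computable2_def by blast
  from rec_in_comp2[OF this assms(2,3)] show ?thesis by simp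
qed

section \<open>Arithmetic functions and decidable relations\<close>

lemma total_rec_add: "total_rec k f \<Longrightarrow> total_rec k g \<Longrightarrow> total_rec k (\<lambda>xs. f xs + g xs)"
  by (rule total_rec_computable2[of "(+)"]) (use peval_pAdd computable2_def in blast)

lemma total_rec_diff: "total_rec k f \<Longrightarrow> total_rec k g \<Longrightarrow> total_rec k (\<lambda>xs. f xs - g xs)"
  by (rule total_rec_computable2[of "\<lambda>m n. n - m" k g f])
    (use peval_pRSub computable2_def in blast)

lemma total_rec_mult:
  assumes "total_rec k f" "total_rec k g" shows "total_rec k (\<lambda>xs. f xs * g xs)"
proof (rule total_rec_computable2[OF _ assms])
  have "peval \<alpha> (PrimRec Zero (Comp pAdd [Proj 1, Proj 2])) [m, n] = Some (m * n)" for \<alpha> m n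
    by (induction m) (simp_all add: peval_pAdd)
  then show "computable2 (*)" unfolding computable2_def by blast
qed

lemma decidable_less:
  assumes "total_rec k f" "total_rec k g" shows "decidable k (\<lambda>xs. f xs < g xs)"
proof -
  have "total_rec k (\<lambda>xs. 1 - (1 - (g xs - f xs)))"
    by (intro total_rec_diff total_rec_const assms)
  moreover have "1 - (1 - (n - m)) = (of_bool (m < n) :: nat)" for m n :: nat by simp
  ultimately show ?thesis by simp
qed

lemma decidable_conj:
  assumes "decidable k P" "decidable k Q" shows "decidable k (\<lambda>xs. P xs \<and> Q xs)"
  using total_rec_mult[OF assms] by (simp add: of_bool_conj)

text \<open>Both branches are total, so both can be evaluated, with the truth value as a
  weight.\<close>

lemma total_rec_if:
  assumes "decidable k P" "total_rec k f" "total_rec k g"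
  shows "total_rec k (\<lambda>xs. if P xs then f xs else g xs)"
proof -
  have "total_rec k (\<lambda>xs. of_bool (P xs) * f xs + (1 - of_bool (P xs)) * g xs)"
    by (intro total_rec_add total_rec_mult total_rec_diff total_rec_const assms)
  moreover have "of_bool p * m + (1 - of_bool p) * n = (if p then m else n)" for p and m n :: nat
    by simp
  ultimately show ?thesis by simp
qed

text \<open>The step program of \<open>PrimRec\<close> sees the predecessor and then the previous
  value, in the order of the arguments of \<open>h\<close>; \<open>f 0\<close> is supplied as a
  constant.\<close>

lemma computable_rec:
  assumes "total_rec 2 (\<lambda>xs. h (xs ! 0) (xs ! 1))" "\<And>n. f (Suc n) = h n (f n)"
  shows "computable f"
proof -
  obtain e where e: "\<And>\<alpha> xs. length xs = 2 \<Longrightarrow> peval \<alpha> e xs = Some (h (xs ! 0) (xs ! 1))"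
    using assms(1) unfolding rec_in_def by blast
  obtain c where c: "\<And>\<alpha> xs. length xs = 0 \<Longrightarrow> peval \<alpha> c xs = Some (f 0)"
    using total_rec_const[of 0 "f 0"] unfolding rec_in_def by blast
  have "peval \<alpha> (PrimRec c e) [n] = Some (f n)" for \<alpha> n
    by (induction n) (simp_all add: c e assms(2))
  then show ?thesis unfolding computable_def by blast
qed

lemma computable_odd: "computable (\<lambda>n. of_bool (odd n))"
  by (rule computable_rec[where h = "\<lambda>_ y. 1 - y"])
    (intro total_rec_diff total_rec_const total_rec_nth, simp_all)

lemma computable_div2: "computable (\<lambda>n. n div 2)"
proof (rule computable_rec[where h = "\<lambda>n y. y + of_bool (odd n)"])
  show "total_rec 2 (\<lambda>xs. xs ! 1 + of_bool (odd (xs ! 0)))"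
    by (intro total_rec_add total_rec_nth total_rec_computable[OF computable_odd]) simp_all
qed (case_tac "even n", simp_all)

lemma computable_pow2: "computable (\<lambda>n. 2 ^ n)"
  by (rule computable_rec[where h = "\<lambda>_ y. y + y"]) (intro total_rec_add total_rec_nth, simp_all)

lemma computable_fst_decode: "computable (\<lambda>z. fst (prod_decode z))"
  unfolding computable_def
proof (intro exI allI)
  show "peval \<alpha> pFst [z] = Some (fst (prod_decode z))" for \<alpha> z
    using peval_pFst[of \<alpha> "fst (prod_decode z)" "snd (prod_decode z)"] by simp
qed

lemma computable_snd_decode: "computable (\<lambda>z. snd (prod_decode z))"
  unfolding computable_def
proof (intro exI allI)
  show "peval \<alpha> pSnd [z] = Some (snd (prod_decode z))" for \<alpha> z
    using peval_pSnd[of \<alpha> "fst (prod_decode z)" "snd (prod_decode z)"] by simp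
qed

text \<open>Below the least zero all values are positive, so the search runs on until it gets there.
  Definedness is asked only at the given oracle and arguments, because the search built later is
  known to be total only for realizers of reals and oracles from \<open>M\<close>.\<close>

lemma rec_in_Mini:
  assumes "rec_in (Suc k) F"
  obtains e where
    "\<And>\<alpha> xs v. length xs = k \<Longrightarrow> (\<And>z. F \<alpha> (z # xs) = Some (v z)) \<Longrightarrow> \<exists>z. v z = 0 \<Longrightarrow>
      peval \<alpha> e xs = Some (LEAST z. v z = 0)"
proof -
  obtain f where f: "\<And>\<alpha> xs. length xs = Suc k \<Longrightarrow> peval \<alpha> f xs = F \<alpha> xs"
    using assms unfolding rec_in_def by blast
  have "peval \<alpha> (Mini f) xs = Some (LEAST z. v z = 0)"
    if "length xs = k" "\<And>z. F \<alpha> (z # xs) = Some (v z)" "\<exists>z. v z = 0" for \<alpha> xs v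
  proof -
    have 1: "peval \<alpha> f (z # xs) = Some (v z)" for z using f that by simp
    have "\<exists>n. v n = 0 \<and> (\<forall>k<n. 0 < v k)"
      using that(3) exists_least_iff[of "\<lambda>z. v z = 0"] by simp
    then show ?thesis unfolding peval.simps(7) 1 by auto
  qed
  then show thesis by (rule that)
qed

text \<open>Since \<open>PrimRec\<close> evaluates its step program only at a successor, it is a conditional that
  does not evaluate the branch not taken.\<close>

lemma rec_in_guard:
  assumes "decidable k P" "rec_in k F"
  shows "rec_in k (\<lambda>\<alpha> xs. if P xs then F \<alpha> xs else Some c)"
proof -
  obtain p where p: "\<And>\<alpha> xs. length xs = k \<Longrightarrow> peval \<alpha> p xs = Some (of_bool (P xs))"
    using assms(1) unfolding rec_in_def by blast
  obtain f where f: "\<And>\<alpha> xs. length xs = k \<Longrightarrow> peval \<alpha> f xs = F \<alpha> xs"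
    using assms(2) unfolding rec_in_def by blast
  obtain d where d: "\<And>\<alpha> xs. length xs = k \<Longrightarrow> peval \<alpha> d xs = Some c"
    using total_rec_const[of k c] unfolding rec_in_def by blast
  \<comment> \<open>\<open>PrimRec\<close> puts the counter and the previous value in front of the
    arguments, so the projections skip two places. The truth value of \<open>P\<close> is the
    recursion depth.\<close>
  let ?g = "Comp f (map (\<lambda>i. Proj (i + 2)) [0..<k])"
  let ?e = "Comp (PrimRec d ?g) (p # map Proj [0..<k])"
  have g: "peval \<alpha> ?g (x # y # xs) = F \<alpha> xs" if "length xs = k" for \<alpha> x y xs
  proof -
    have "map (\<lambda>g. the (peval \<alpha> g (x # y # xs))) (map (\<lambda>i. Proj (i + 2)) [0..<k]) = xs"
      using that by (intro nth_equalityI) simp_all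
    with that show ?thesis by (simp add: f del: map_map)
  qed
  have "peval \<alpha> ?e xs = (if P xs then F \<alpha> xs else Some c)" if l: "length xs = k" for \<alpha> xs
  proof -
    have "map (\<lambda>g. the (peval \<alpha> g xs)) (map Proj [0..<k]) = xs"
      using l by (intro nth_equalityI) simp_all
    then have "peval \<alpha> ?e xs = peval \<alpha> (PrimRec d ?g) (of_bool (P xs) # xs)"
      using l by (simp add: p del: peval.simps(6) map_map)
    also have "\<dots> = (if P xs then F \<alpha> xs else Some c)"
      using g[OF l] by (simp add: d l del: peval.simps(5))
    finally show ?thesis .
  qed
  then show ?thesis unfolding rec_in_def by blast
qed


section \<open>Computable rational functions\<close>

text \<open>Programs return only natural numbers, so a rational value is presented as a difference
  of naturals over a positive denominator, not necessarily reduced.\<close>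

definition rat_rec :: "nat \<Rightarrow> (nat list \<Rightarrow> rat) \<Rightarrow> bool" where
  "rat_rec k F \<longleftrightarrow> (\<exists>A B C. total_rec k A \<and> total_rec k B \<and> total_rec k C \<and>
     (\<forall>xs. C xs > 0 \<and> F xs = (of_nat (A xs) - of_nat (B xs)) / of_nat (C xs)))"

lemma rat_recI:
  assumes "total_rec k A" "total_rec k B" "total_rec k C" "\<And>xs. C xs > 0"
    "\<And>xs. F xs = (of_nat (A xs) - of_nat (B xs)) / of_nat (C xs)"
  shows "rat_rec k F"
  using assms unfolding rat_rec_def by blast

lemma rat_rec_add:
  assumes "rat_rec k F" "rat_rec k G" shows "rat_rec k (\<lambda>xs. F xs + G xs)"
proof -
  obtain A B C where F: "total_rec k A" "total_rec k B" "total_rec k C" "\<And>xs. C xs > 0"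
    "\<And>xs. F xs = (of_nat (A xs) - of_nat (B xs)) / of_nat (C xs)"
    using assms(1) unfolding rat_rec_def by blast
  obtain A' B' C' where G: "total_rec k A'" "total_rec k B'" "total_rec k C'" "\<And>xs. C' xs > 0"
    "\<And>xs. G xs = (of_nat (A' xs) - of_nat (B' xs)) / of_nat (C' xs)"
    using assms(2) unfolding rat_rec_def by blast
  show ?thesis
  proof (rule rat_recI)
    show "total_rec k (\<lambda>xs. A xs * C' xs + A' xs * C xs)"
      "total_rec k (\<lambda>xs. B xs * C' xs + B' xs * C xs)" "total_rec k (\<lambda>xs. C xs * C' xs)"
      by (intro total_rec_add total_rec_mult F G)+
    fix xs
    show "C xs * C' xs > 0" using F(4) G(4) by simp
    show "F xs + G xs = (of_nat (A xs * C' xs + A' xs * C xs) -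
        of_nat (B xs * C' xs + B' xs * C xs)) / of_nat (C xs * C' xs)"
      using F(4)[of xs] G(4)[of xs] by (simp add: F(5) G(5) field_simps)
  qed
qed

text \<open>The denominators are positive, so clearing them and moving subtracted terms to the other
  side leaves a comparison of natural numbers.\<close>

lemma decidable_rat_less:
  assumes "rat_rec k F" "rat_rec k G" shows "decidable k (\<lambda>xs. F xs < G xs)"
proof -
  obtain A B C where F: "total_rec k A" "total_rec k B" "total_rec k C" "\<And>xs. C xs > 0"
    "\<And>xs. F xs = (of_nat (A xs) - of_nat (B xs)) / of_nat (C xs)"
    using assms(1) unfolding rat_rec_def by blast
  obtain A' B' C' where G: "total_rec k A'" "total_rec k B'" "total_rec k C'" "\<And>xs. C' xs > 0"
    "\<And>xs. G xs = (of_nat (A' xs) - of_nat (B' xs)) / of_nat (C' xs)"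
    using assms(2) unfolding rat_rec_def by blast
  have "(F xs < G xs) = (A xs * C' xs + B' xs * C xs < A' xs * C xs + B xs * C' xs)" for xs
  proof -
    have "(F xs < G xs) = ((of_nat (A xs * C' xs + B' xs * C xs) :: rat) <
        of_nat (A' xs * C xs + B xs * C' xs))"
      using F(4)[of xs] G(4)[of xs] by (simp add: F(5) G(5) field_simps)
    then show ?thesis by (simp only: of_nat_less_iff)
  qed
  then show ?thesis
    by simp (intro decidable_less total_rec_add total_rec_mult F G)
qed

lemma rat_rec_if:
  assumes "decidable k P" "rat_rec k F" "rat_rec k G"
  shows "rat_rec k (\<lambda>xs. if P xs then F xs else G xs)"
proof -
  obtain A B C where F: "total_rec k A" "total_rec k B" "total_rec k C" "\<And>xs. C xs > 0"
    "\<And>xs. F xs = (of_nat (A xs) - of_nat (B xs)) / of_nat (C xs)"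
    using assms(2) unfolding rat_rec_def by blast
  obtain A' B' C' where G: "total_rec k A'" "total_rec k B'" "total_rec k C'" "\<And>xs. C' xs > 0"
    "\<And>xs. G xs = (of_nat (A' xs) - of_nat (B' xs)) / of_nat (C' xs)"
    using assms(3) unfolding rat_rec_def by blast
  show ?thesis
    by (rule rat_recI[where A = "\<lambda>xs. if P xs then A xs else A' xs"
          and B = "\<lambda>xs. if P xs then B xs else B' xs" and C = "\<lambda>xs. if P xs then C xs else C' xs"])
      (use F G in \<open>auto intro!: total_rec_if assms(1)\<close>)
qed

lemma rat_rec_const: "rat_rec k (\<lambda>_. r)"
proof -
  obtain a b where r: "quotient_of r = (a, b)" by fastforce
  from quotient_of_div[OF this] quotient_of_denom_pos[OF this] show ?thesis
    by (intro rat_recI[where A = "\<lambda>_. nat a" and B = "\<lambda>_. nat (- a)" and C = "\<lambda>_. nat b"])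
      (auto simp: total_rec_const of_nat_nat)
qed

lemma rat_rec_half_power:
  assumes "total_rec k f" shows "rat_rec k (\<lambda>xs. (1/2) ^ f xs)"
proof (rule rat_recI[where A = "\<lambda>_. 1" and B = "\<lambda>_. 0"])
  show "total_rec k (\<lambda>xs. 2 ^ f xs)" by (rule total_rec_computable[OF computable_pow2 assms])
qed (simp_all add: total_rec_const power_divide)

lemma rat_rec_enum:
  assumes "computable_rat_enum q" "total_rec k f" shows "rat_rec k (\<lambda>xs. q (f xs))"
proof -
  let ?num = "\<lambda>n. fst (quotient_of (q n))" and ?den = "\<lambda>n. snd (quotient_of (q n))"
  let ?h = "\<lambda>n. int_encode (?num n)"
  have h: "total_rec k (\<lambda>xs. ?h (f xs))" and d: "total_rec k (\<lambda>xs. nat (?den (f xs)))"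
    using assms total_rec_computable unfolding computable_rat_enum_def by blast+
  \<comment> \<open>Even codes stand for the non-negative integers and odd codes for the negative
    ones; the shift by one keeps zero from having two codes.\<close>
  have decode: "int_decode z = int (if odd z then 0 else z div 2) -
      int (if odd z then z div 2 + 1 else 0)" for z
    by (simp add: int_decode_def sum_decode_def)
  show ?thesis
  proof (rule rat_recI[OF _ _ d])
    have o: "decidable k (\<lambda>xs. odd (?h (f xs)))" and
      v: "total_rec k (\<lambda>xs. ?h (f xs) div 2)"
      using total_rec_computable[OF computable_odd h] total_rec_computable[OF computable_div2 h] .
    show "total_rec k (\<lambda>xs. if odd (?h (f xs)) then 0 else ?h (f xs) div 2)"
      by (intro total_rec_if o v total_rec_const)
    show "total_rec k (\<lambda>xs. if odd (?h (f xs)) then ?h (f xs) div 2 + 1 else 0)"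
      by (intro total_rec_if o v total_rec_const total_rec_add)
    fix xs
    let ?n = "f xs"
    have pos: "?den ?n > 0" by (rule quotient_of_denom_pos')
    then show "nat (?den ?n) > 0" by simp
    have "of_int (?num ?n) = of_nat (if odd (?h ?n) then 0 else ?h ?n div 2) -
        (of_nat (if odd (?h ?n) then ?h ?n div 2 + 1 else 0) :: rat)"
      using arg_cong[OF decode[of "?h ?n"], of "of_int :: int \<Rightarrow> rat"]
      by (simp only: int_encode_inverse of_int_diff of_int_of_nat_eq)
    moreover have "q ?n = of_int (?num ?n) / of_int (?den ?n)"
      by (rule quotient_of_div) simp
    moreover have "of_nat (nat (?den ?n)) = (of_int (?den ?n) :: rat)" using pos by simp
    ultimately show "q ?n = (of_nat (if odd (?h ?n) then 0 else ?h ?n div 2) -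
        of_nat (if odd (?h ?n) then ?h ?n div 2 + 1 else 0)) / of_nat (nat (?den ?n))"
      by (simp only:)
  qed
qed


section \<open>Cuts of the rationals\<close>

text \<open>This is max(0, min(1, r + 1/2)), with the critical point 0 sent to 1/2. Strict tests
  keep it within reach of \<open>rat_rec_if\<close>; the type is left open because it acts both on
  rational endpoints and on the real between them.\<close>

definition shift_clamp :: "'a :: linordered_field \<Rightarrow> 'a" where
  "shift_clamp r = (if 0 < r + 1/2 then if r + 1/2 < 1 then r + 1/2 else 1 else 0)"

lemma shift_clamp_mono: "a \<le> b \<Longrightarrow> shift_clamp a \<le> shift_clamp b"
  by (auto simp: shift_clamp_def)

text \<open>Clamping does not stretch distances, so a short interval around the real has a short
  image.\<close>

lemma shift_clamp_diff_le: "a \<le> b \<Longrightarrow> shift_clamp b \<le> shift_clamp a + (b - a)"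
  by (auto simp: shift_clamp_def)

lemma shift_clamp_interval: "shift_clamp a \<in> {0..1}"
  by (auto simp: shift_clamp_def)

lemma shift_clamp_le_half: "shift_clamp a \<le> 1/2 \<Longrightarrow> a \<le> 0"
  by (auto simp: shift_clamp_def split: if_splits)

lemma shift_clamp_ge_half: "1/2 \<le> shift_clamp a \<Longrightarrow> 0 \<le> a"
  by (auto simp: shift_clamp_def split: if_splits)

lemma of_rat_shift_clamp: "of_rat (shift_clamp r) = (shift_clamp (of_rat r) :: real)"
proof -
  have h: "of_rat r + 1/2 = (of_rat (r + 1/2) :: real)" by (simp add: of_rat_add of_rat_divide)
  show ?thesis unfolding shift_clamp_def h by (simp add: of_rat_less_1_iff zero_less_of_rat_iff)
qed

lemma rat_rec_shift_clamp: "rat_rec k F \<Longrightarrow> rat_rec k (\<lambda>xs. shift_clamp (F xs))"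
  unfolding shift_clamp_def
  by (intro rat_rec_if decidable_rat_less rat_rec_add rat_rec_const)

text \<open>Meant for the classical predicates that \<open>fst x a\<close> or \<open>snd x b\<close>
  has a realizer. Locatedness enters separately, through the answers of a comparison
  procedure.\<close>

locale rational_cut =
  fixes L U :: "rat \<Rightarrow> bool"
  assumes L_ex: "\<exists>a. L a" and U_ex: "\<exists>b. U b"
    and L_rounded: "L a \<longleftrightarrow> (\<exists>b. a < b \<and> L b)" and U_rounded: "U b \<longleftrightarrow> (\<exists>a. a < b \<and> U a)"
    and disjoint: "\<not> (L a \<and> U a)"
begin

definition cut_real :: real where
  "cut_real = Sup (of_rat ` {a. L a})"

lemma L_downward: "L b \<Longrightarrow> a \<le> b \<Longrightarrow> L a"
  using L_rounded[of a] by (cases "a = b") auto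

lemma U_upward: "U a \<Longrightarrow> a \<le> b \<Longrightarrow> U b"
  using U_rounded[of b] by (cases "a = b") auto

lemma L_less_U: "L a \<Longrightarrow> U b \<Longrightarrow> a < b"
  using L_downward[of a b] disjoint[of b] by force

text \<open>Roundedness gives strictness: a larger element of \<open>L\<close> is still at most the
  supremum, which exists because elements of \<open>U\<close> are upper bounds.\<close>

lemma L_less_cut_real:
  assumes "L a" shows "of_rat a < cut_real"
proof -
  obtain b where b: "a < b" "L b" using assms L_rounded by blast
  obtain c where "U c" using U_ex by blast
  then have "bdd_above (real_of_rat ` {a. L a})"
    by (intro bdd_aboveI2[of _ _ "of_rat c"])
      (use L_less_U in \<open>auto simp: of_rat_less_eq less_imp_le\<close>)
  then have "of_rat b \<le> cut_real" unfolding cut_real_def using b by (intro cSup_upper) auto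
  moreover have "real_of_rat a < of_rat b" using b by (simp add: of_rat_less)
  ultimately show ?thesis by linarith
qed

lemma cut_real_less_U:
  assumes "U b" shows "cut_real < of_rat b"
proof -
  obtain a where a: "a < b" "U a" using assms U_rounded by blast
  have "cut_real \<le> of_rat a"
    unfolding cut_real_def using L_ex L_less_U[OF _ a(2)]
    by (intro cSup_least) (auto simp: of_rat_less_eq less_imp_le)
  moreover have "real_of_rat a < of_rat b" using a by (simp add: of_rat_less)
  ultimately show ?thesis by linarith
qed

text \<open>Walk along a fine grid from an element of \<open>L\<close> past an element of
  \<open>U\<close>. The first comparison must be answered yes and some later one no; at the first
  no, the comparison just before was a yes. The answers may be otherwise erratic.\<close>

lemma ex_close_sides:
  assumes "\<epsilon> > 0"
    and side: "\<And>a b. a < b \<Longrightarrow> (if s a b then L a else U b)"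
  shows "\<exists>a c b. a < c \<and> c < b \<and> b < a + \<epsilon> \<and> s a c \<and> \<not> s c b"
proof -
  obtain l where l: "L l" using L_ex by blast
  obtain u where u: "U u" using U_ex by blast
  define \<delta> where "\<delta> = \<epsilon> / 4"
  have \<delta>: "\<delta> > 0" using assms(1) by (simp add: \<delta>_def)
  \<comment> \<open>The grid starts one step below \<open>l\<close>, so \<open>c 1\<close> is
    \<open>l\<close>: a no at the first comparison would put \<open>l\<close> into
    \<open>U\<close>.\<close>
  define c where "c k = l + (of_nat k - 1) * \<delta>" for k :: nat
  have step: "c (Suc k) = c k + \<delta>" for k by (simp add: c_def algebra_simps)
  have 0: "s (c 0) (c 1)"
    using side[of "c 0" "c 1"] disjoint[of l] l \<delta> by (auto simp: c_def split: if_splits)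
  obtain k :: nat where k: "(u - l) / \<delta> + 1 \<le> of_nat k"
    using real_arch_simple[of "(u - l) / \<delta> + 1"] by blast
  then have "u \<le> c k" using \<delta> by (simp add: c_def field_simps)
  then have "\<not> L (c k)" using U_upward[OF u] disjoint by blast
  then have "\<not> s (c k) (c (Suc k))"
    using side[of "c k" "c (Suc k)"] \<delta> step by (auto split: if_splits)
  then have ex: "\<exists>k. \<not> s (c k) (c (Suc k))" by blast
  define m where "m = (LEAST k. \<not> s (c k) (c (Suc k)))"
  have m: "\<not> s (c m) (c (Suc m))" unfolding m_def using ex by (rule LeastI_ex)
  then obtain m' where m': "m = Suc m'" using 0 by (cases m) auto
  then have "s (c m') (c m)"
    using not_less_Least[of m' "\<lambda>k. \<not> s (c k) (c (Suc k))", folded m_def] by simp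
  moreover have "c (Suc m) < c m' + \<epsilon>" using \<delta> step m' by (simp add: \<delta>_def)
  moreover have "c m' < c m" "c m < c (Suc m)" using \<delta> step m' by simp_all
  ultimately show ?thesis using m by blast
qed

end


section \<open>Realizers of Dedekind reals\<close>

lemma t_conj_nonempty: "t_conj T A B \<noteq> {} \<longleftrightarrow> A \<noteq> {} \<and> B \<noteq> {}"
  by (auto simp: t_conj_def)

lemma truth_value_nonempty: "truth_value P \<noteq> {} \<longleftrightarrow> P"
  by (simp add: truth_value_def)

text \<open>The last conjunct of \<open>dedekind_cut\<close>, isolated because its realizers are run
  as programs; from the other conjuncts only the existence of realizers is used.\<close>

definition locatedness :: "('p, nat) app_struct \<Rightarrow> (nat \<Rightarrow> rat) \<Rightarrow> cut \<Rightarrow> nat set" where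
  "locatedness T q x = rat_all T q (\<lambda>a. rat_all T q (\<lambda>b.
     t_imp T (truth_value (a < b)) (t_disj T (fst x a) (snd x b))))"

text \<open>If \<open>w\<close> turns realizers of a real into realizers of its locatedness, \<open>e\<close> realizes a real and
  \<open>i\<close>, \<open>j\<close> are codes of rationals \<open>a < b\<close>, then this asks for one of \<open>a < x\<close> (answer \<open>0\<close>)
  and \<open>x < b\<close> (answer \<open>1\<close>). The arguments \<open>0\<close> before \<open>ctrue\<close> are dummies for quantifiers and
  truth values.\<close>

definition side ::
    "('p, nat) app_struct \<Rightarrow> nat \<Rightarrow> 'p \<Rightarrow> nat \<Rightarrow> nat \<Rightarrow> nat \<Rightarrow> nat option" where
  "side T w p e i j =
     foldl (oapp T p) (Some w) (map Some [e, 0, i, 0, j, 0, ctrue T, 0, 1])"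

context
  fixes T :: "('p, nat) app_struct" and q :: "nat \<Rightarrow> rat"
  assumes T: "ppca T" and q: "surj q"
begin

text \<open>A realizer of the implication can be run at any one parameter. With this and its
  companions, existence of realizers turns validity in the tripos into classical truth.\<close>

lemma t_imp_nonempty: "t_imp T A B \<noteq> {} \<Longrightarrow> A \<noteq> {} \<Longrightarrow> B \<noteq> {}"
  using some_param[OF T] unfolding t_imp_def by blast

lemma t_AllD: "c \<in> t_All T \<psi> \<Longrightarrow> p \<in> params T \<Longrightarrow> \<exists>d\<in>\<psi> y. app T p c b = Some d"
  unfolding t_All_def t_all_along_def by simp

lemma t_All_nonempty: "t_All T \<psi> \<noteq> {} \<Longrightarrow> \<psi> y \<noteq> {}"
  using t_AllD[OF _ some_param[OF T], of _ \<psi> y] by blast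

lemma rat_object_nonempty: "rat_object q a a \<noteq> {}"
  using surjD[OF q, of a] unfolding rat_object_def by blast

lemma rat_all_nonempty: "rat_all T q \<psi> \<noteq> {} \<Longrightarrow> \<psi> a \<noteq> {}"
  unfolding rat_all_def all_in_def
  by (drule t_All_nonempty[of _ a], drule t_imp_nonempty[OF _ rat_object_nonempty])

lemma rat_ex_nonempty: "rat_ex T q \<psi> \<noteq> {} \<longleftrightarrow> (\<exists>a. \<psi> a \<noteq> {})"
proof -
  have "rat_ex T q \<psi> \<noteq> {} \<longleftrightarrow> (\<exists>a. t_conj T (rat_object q a a) (\<psi> a) \<noteq> {})"
    unfolding rat_ex_def ex_in_def t_Ex_eq[OF T] by blast
  then show ?thesis unfolding t_conj_nonempty using rat_object_nonempty by blast
qed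

text \<open>Existence of realizers commutes with conjunction and existence and passes through
  implications and universal quantifiers, so each cut axiom yields its classical
  counterpart.\<close>

lemma rational_cut_dedekind:
  assumes "dedekind_reals T q x x \<noteq> {}"
  shows "rational_cut (\<lambda>a. fst x a \<noteq> {}) (\<lambda>b. snd x b \<noteq> {})"
proof -
  have "dedekind_cut T q x \<noteq> {}"
    using assms unfolding dedekind_reals_def t_conj_nonempty by blast
  then have
    L: "rat_ex T q (fst x) \<noteq> {}" and U: "rat_ex T q (snd x) \<noteq> {}" and
    LR: "rat_all T q (\<lambda>a. t_iff T (fst x a)
      (rat_ex T q (\<lambda>b. t_conj T (truth_value (a < b)) (fst x b)))) \<noteq> {}" and
    UR: "rat_all T q (\<lambda>b. t_iff T (snd x b)
      (rat_ex T q (\<lambda>a. t_conj T (truth_value (a < b)) (snd x a)))) \<noteq> {}" and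
    D: "rat_all T q (\<lambda>a. t_not T (t_conj T (fst x a) (snd x a))) \<noteq> {}"
    unfolding dedekind_cut_def split_beta t_conj_nonempty by blast+
  have iff: "A \<noteq> {} \<longleftrightarrow> B \<noteq> {}" if "t_iff T A B \<noteq> {}" for A B
    using that t_imp_nonempty unfolding t_iff_def t_conj_nonempty by blast
  show ?thesis
  proof
    show "\<exists>a. fst x a \<noteq> {}" "\<exists>b. snd x b \<noteq> {}" using L U unfolding rat_ex_nonempty by blast+
    show "fst x a \<noteq> {} \<longleftrightarrow> (\<exists>b. a < b \<and> fst x b \<noteq> {})" for a
      using iff[OF rat_all_nonempty[OF LR, of a]]
      unfolding rat_ex_nonempty t_conj_nonempty truth_value_nonempty .
    show "snd x b \<noteq> {} \<longleftrightarrow> (\<exists>a. a < b \<and> snd x a \<noteq> {})" for b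
      using iff[OF rat_all_nonempty[OF UR, of b]]
      unfolding rat_ex_nonempty t_conj_nonempty truth_value_nonempty .
    show "\<not> (fst x a \<noteq> {} \<and> snd x a \<noteq> {})" for a
      using rat_all_nonempty[OF D, of a] t_imp_nonempty[of _ "{}"]
      unfolding t_not_def t_conj_nonempty[of T, symmetric] by blast
  qed
qed

lemma entails_locatedness: "entails T (\<lambda>x. dedekind_reals T q x x) (locatedness T q)"
proof -
  have "entails T (\<lambda>x. dedekind_reals T q x x) (dedekind_cut T q)"
    by (rule reals_fwd(3)[OF T ent_refl[OF T]])
  then have "entails T (\<lambda>x. dedekind_reals T q x x) (\<lambda>x. dedekind_cut T q x)" .
  from ent_conjD2[OF T ent_conjD2[OF T ent_conjD2[OF T ent_conjD2[OF T ent_conjD2[OF T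
    this[unfolded dedekind_cut_def split_beta]]]]]]
  show ?thesis unfolding locatedness_def[abs_def] .
qed

text \<open>The answer may vary with \<open>p\<close>, but it is the tag of a realizer of the
  disjunction, and the tagged component witnesses the chosen disjunct.\<close>

lemma side_cases:
  assumes w: "\<And>x e p. e \<in> dedekind_reals T q x x \<Longrightarrow> p \<in> params T \<Longrightarrow>
      \<exists>c\<in>locatedness T q x. app T p w e = Some c"
    and e: "e \<in> dedekind_reals T q x x" and p: "p \<in> params T" and less: "q i < q j"
  shows "side T w p e i j = Some 0 \<and> fst x (q i) \<noteq> {} \<or>
    side T w p e i j = Some 1 \<and> snd x (q j) \<noteq> {}"
proof -
  obtain c where c: "c \<in> locatedness T q x" "app T p w e = Some c" using w[OF e p] by blast
  have all: "\<exists>a' b'. app T p a 0 = Some a' \<and> app T p a' n = Some b' \<and> b' \<in> \<psi> (q n)"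
    if a: "a \<in> rat_all T q \<psi>" for a n \<psi>
  proof -
    obtain a' where a': "app T p a 0 = Some a'" "a' \<in> t_imp T (rat_object q (q n) (q n)) (\<psi> (q n))"
      using t_AllD[OF a[unfolded rat_all_def all_in_def] p, where b = 0 and y = "q n"] by blast
    moreover have "n \<in> rat_object q (q n) (q n)" by (simp add: rat_object_def)
    ultimately show ?thesis using p unfolding t_imp_def by blast
  qed
  obtain c1 c2 where c2: "app T p c 0 = Some c1" "app T p c1 i = Some c2"
    "c2 \<in> rat_all T q (\<lambda>b. t_imp T (truth_value (q i < b)) (t_disj T (fst x (q i)) (snd x b)))"
    using all[OF c(1)[unfolded locatedness_def]] by blast
  obtain c3 c4 where c4: "app T p c2 0 = Some c3" "app T p c3 j = Some c4"
    "c4 \<in> t_imp T (truth_value (q i < q j)) (t_disj T (fst x (q i)) (snd x (q j)))"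
    using all[OF c2(3)] by blast
  have "0 \<in> truth_value (q i < q j)" using less by (simp add: truth_value_def)
  then obtain d where d: "app T p c4 0 = Some d" "d \<in> t_disj T (fst x (q i)) (snd x (q j))"
    using c4(3) p unfolding t_imp_def by blast
  \<comment> \<open>Applied to \<open>ctrue\<close>, the pair \<open>d\<close> returns its tag, and
    the tag selects between the arguments \<open>0\<close> and \<open>1\<close>.\<close>
  have eq: "side T w p e i j = oapp T p (oapp T p (app T p d (ctrue T)) (Some 0)) (Some 1)"
    by (simp add: side_def oapp_Some[OF T] c c2 c4 d)
  show ?thesis
    using d(2) unfolding t_disj_def
    by (elim UnE CollectE exE conjE)
      (auto simp: eq app_pair[OF T p] app_simps[OF T] ctrue_def cfalse_def p oapp_Some[OF T])
qed

end


section \<open>Deciding the sign\<close>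

text \<open>The digits after the first contribute between 0 and 1/2 in total.\<close>

lemma bin_real_first_digit:
  shows "\<alpha> 0 \<Longrightarrow> 1/2 \<le> bin_real \<alpha>" and "\<not> \<alpha> 0 \<Longrightarrow> bin_real \<alpha> \<le> 1/2"
proof -
  let ?f = "\<lambda>i. of_bool (\<alpha> i) * (1/2 :: real) ^ (i + 1)"
  have "summable (\<lambda>i. (1/2 :: real) ^ (i + 1))" using power_half_series by (simp add: sums_iff)
  then have sm: "summable ?f" by (rule summable_comparison_test'[of _ 0]) simp
  then have eq: "bin_real \<alpha> = of_bool (\<alpha> 0) / 2 + (\<Sum>i. ?f (Suc i))"
    using suminf_split_head[OF sm] unfolding bin_real_def by simp
  have sm': "summable (\<lambda>i. ?f (Suc i))" using sm by (subst summable_Suc_iff)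
  have half: "(\<lambda>i. (1/2 :: real) ^ (Suc i + 1)) sums (1/2)"
    using sums_mult[OF power_half_series, of "1/2"] by simp
  have "(\<Sum>i. ?f (Suc i)) \<le> (\<Sum>i. (1/2) ^ (Suc i + 1))"
    by (rule suminf_le[OF _ sm' sums_summable[OF half]]) simp
  also have "\<dots> = 1/2" by (rule sums_unique[OF half, symmetric])
  finally have le: "(\<Sum>i. ?f (Suc i)) \<le> 1/2" .
  have ge: "0 \<le> (\<Sum>i. ?f (Suc i))" by (rule suminf_nonneg[OF sm']) simp
  show "\<alpha> 0 \<Longrightarrow> 1/2 \<le> bin_real \<alpha>" "\<not> \<alpha> 0 \<Longrightarrow> bin_real \<alpha> \<le> 1/2"
    using le ge by (simp_all add: eq)
qed

section \<open>Approximating a real by search and reading its sign from the oracle\<close>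

context
  fixes \<phi> :: "(nat \<Rightarrow> bool) \<Rightarrow> nat \<Rightarrow> nat \<Rightarrow> nat option" and M :: "(nat \<Rightarrow> bool) set"
    and T :: "(nat \<Rightarrow> bool, nat) app_struct" and q :: "nat \<Rightarrow> rat"
  assumes \<phi>: "acceptable \<phi>" and M: "M \<noteq> {}" and q: "computable_rat_enum q"
    and T_def: "T = oracle_struct \<phi> M"
begin

lemma ppca_T: "ppca T"
  unfolding T_def by (rule ppca_oracle_struct[OF \<phi> M])

lemma params_T: "params T = M" and app_T: "app T = \<phi>"
  by (simp_all add: T_def oracle_struct_def)

lemma bij_q: "bij q"
  using q by (simp add: computable_rat_enum_def)

lemma smn: "\<exists>c. computable c \<and> (\<forall>\<alpha> m n. \<phi> \<alpha> (c m) n = peval \<alpha> e [m, n])"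
  using \<phi> unfolding acceptable_def by blast

lemma rec_in_oapp:
  assumes "rec_in k F" "rec_in k G" shows "rec_in k (\<lambda>\<alpha> xs. oapp T \<alpha> (F \<alpha> xs) (G \<alpha> xs))"
proof -
  obtain u where "\<And>\<alpha> m n. peval \<alpha> u [m, n] = \<phi> \<alpha> m n"
    using \<phi> unfolding acceptable_def by metis
  from rec_in_comp2[OF this assms] show ?thesis by (simp add: oapp_def app_T)
qed

lemma rec_in_side:
  assumes "total_rec k e" "total_rec k i" "total_rec k j"
  shows "rec_in k (\<lambda>\<alpha> xs. side T w \<alpha> (e xs) (i xs) (j xs))"
  unfolding side_def list.map foldl.simps
  by (intro rec_in_oapp total_rec_const assms)

text \<open>The first argument becomes part of the index, and \<open>c\<close> consults no oracle;
  so an index for a real can depend on its realizer alone.\<close>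

lemma rec_in_smn:
  assumes "rec_in 2 F"
  obtains c where "computable c" "\<And>\<alpha> m n. \<phi> \<alpha> (c m) n = F \<alpha> [m, n]"
proof -
  obtain e where "\<And>\<alpha> xs. length xs = 2 \<Longrightarrow> peval \<alpha> e xs = F \<alpha> xs"
    using assms unfolding rec_in_def by blast
  then show thesis using smn[of e] that by auto
qed

text \<open>A search for \<open>(m, i, c, j)\<close> such that the real lies between \<open>q i\<close> and \<open>q j\<close>, on the evidence
  of comparisons with \<open>q c\<close>, and such that \<open>q m\<close> is close enough to the image of this interval.\<close>

definition close_codes :: "nat \<Rightarrow> nat \<Rightarrow> nat \<Rightarrow> nat \<Rightarrow> nat \<Rightarrow> bool" where
  "close_codes n m i c j \<longleftrightarrow> q i < q c \<and> q c < q j \<and> q j < q i + (1/2) ^ n \<and>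
     shift_clamp (q j) < q m + (1/2) ^ n \<and> q m < shift_clamp (q i) + (1/2) ^ n"

text \<open>The real is the supremum of the lower cut, chosen before the oracle. The approximations
  found may differ between oracles, but all of them approach it.\<close>

lemma ex_index_of_real:
  "\<exists>g. computable g \<and> (\<forall>x. \<forall>e\<in>dedekind_reals T q x x. \<exists>y. \<forall>\<alpha>\<in>M.
     represents q (\<phi> \<alpha> (g e)) (shift_clamp y) \<and>
     (snd x 0 \<noteq> {} \<longrightarrow> y < 0) \<and> (fst x 0 \<noteq> {} \<longrightarrow> 0 < y))"
proof -
  have surj: "surj q" using bij_q by (rule bij_is_surj)
  obtain w where w: "\<And>x e p. e \<in> dedekind_reals T q x x \<Longrightarrow> p \<in> params T \<Longrightarrow>
      \<exists>c\<in>locatedness T q x. app T p w e = Some c"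
    using entails_locatedness[OF ppca_T surj] unfolding entails_def by blast
  \<comment> \<open>One number codes the quadruple, so that a single unbounded search ranges over
    it.\<close>
  define mm ii cc jj where "mm z = fst (prod_decode z)" and
    "ii z = fst (prod_decode (snd (prod_decode z)))" and
    "cc z = fst (prod_decode (snd (prod_decode (snd (prod_decode z)))))" and
    "jj z = snd (prod_decode (snd (prod_decode (snd (prod_decode z)))))" for z
  note dec = total_rec_computable[OF computable_fst_decode]
    total_rec_computable[OF computable_snd_decode]
  have z: "total_rec 3 (\<lambda>xs. mm (xs ! 0))" "total_rec 3 (\<lambda>xs. ii (xs ! 0))"
    "total_rec 3 (\<lambda>xs. cc (xs ! 0))" "total_rec 3 (\<lambda>xs. jj (xs ! 0))"
    and en: "total_rec 3 (\<lambda>xs. xs ! 1)" "total_rec 3 (\<lambda>xs. xs ! 2)"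
    unfolding mm_def ii_def cc_def jj_def by (intro dec total_rec_nth; simp)+
  let ?good = "\<lambda>n z. close_codes n (mm z) (ii z) (cc z) (jj z)"
  have good: "decidable 3 (\<lambda>xs. ?good (xs ! 2) (xs ! 0))"
    unfolding close_codes_def
    by (intro decidable_conj decidable_rat_less rat_rec_add rat_rec_shift_clamp
        rat_rec_half_power rat_rec_enum[OF q] z en)
  have "total_rec 2 (\<lambda>xs. xs ! 0 + (1 - xs ! 1))"
    by (intro total_rec_add total_rec_diff total_rec_const total_rec_nth) simp_all
  then obtain d where d: "\<And>\<alpha> xs. length xs = 2 \<Longrightarrow> peval \<alpha> d xs = Some (xs ! 0 + (1 - xs ! 1))"
    unfolding rec_in_def by blast
  \<comment> \<open>The value is \<open>0\<close> exactly for a good quadruple with answers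
    \<open>0\<close> and then \<open>1\<close>. The guard matters: \<open>side\<close> may be
    undefined when the rationals are not in order.\<close>
  define F where "F \<alpha> xs = (if ?good (xs ! 2) (xs ! 0) then
      Option.bind (side T w \<alpha> (xs ! 1) (ii (xs ! 0)) (cc (xs ! 0))) (\<lambda>s.
      Option.bind (side T w \<alpha> (xs ! 1) (cc (xs ! 0)) (jj (xs ! 0))) (\<lambda>t. Some (s + (1 - t))))
      else Some 1)" for \<alpha> and xs :: "nat list"
  have "peval \<alpha> d [s, t] = Some (s + (1 - t))" for \<alpha> s t using d[of "[s, t]" \<alpha>] by simp
  then have "rec_in 3 F"
    unfolding F_def[abs_def] by (intro rec_in_guard rec_in_comp2 rec_in_side good z en)
  then have "rec_in (Suc 2) F" by (simp add: eval_nat_numeral)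
  then obtain f where f: "\<And>\<alpha> xs v. length xs = 2 \<Longrightarrow> (\<And>z. F \<alpha> (z # xs) = Some (v z)) \<Longrightarrow>
      \<exists>z. v z = 0 \<Longrightarrow> peval \<alpha> f xs = Some (LEAST z. v z = 0)"
    by (rule rec_in_Mini) blast
  obtain e' where e': "\<And>\<alpha> z. peval \<alpha> e' [z] = Some (mm z)"
    using computable_fst_decode unfolding computable_def mm_def by blast
  have "rec_in 2 (\<lambda>\<alpha> xs. Option.bind (peval \<alpha> f xs) (\<lambda>z. Some (mm z)))"
    by (rule rec_in_comp1[OF e']) (use rec_in_def in blast)
  then obtain g where g: "computable g"
    "\<And>\<alpha> e n. \<phi> \<alpha> (g e) n = Option.bind (peval \<alpha> f [e, n]) (\<lambda>z. Some (mm z))"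
    by (rule rec_in_smn) blast
  have "\<exists>y. \<forall>\<alpha>\<in>M. represents q (\<phi> \<alpha> (g e)) (shift_clamp y) \<and>
      (snd x 0 \<noteq> {} \<longrightarrow> y < 0) \<and> (fst x 0 \<noteq> {} \<longrightarrow> 0 < y)" if e: "e \<in> dedekind_reals T q x x" for x e
  proof -
    interpret rational_cut "\<lambda>a. fst x a \<noteq> {}" "\<lambda>b. snd x b \<noteq> {}"
      using e by (intro rational_cut_dedekind[OF ppca_T surj]) blast
    let ?y = cut_real
    have "represents q (\<phi> \<alpha> (g e)) (shift_clamp ?y)" if \<alpha>: "\<alpha> \<in> M" for \<alpha>
      unfolding represents_def
    proof
      fix n
      let ?\<epsilon> = "(1/2 :: rat) ^ n"
      define s where "s i j = the (side T w \<alpha> e i j)" for i j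
      have side: "side T w \<alpha> e i j = Some (s i j) \<and>
          (s i j = 0 \<and> fst x (q i) \<noteq> {} \<or> s i j = 1 \<and> snd x (q j) \<noteq> {})" if "q i < q j" for i j
        using side_cases[OF ppca_T surj w e, of \<alpha> i j] that \<alpha> by (auto simp: params_T s_def)
      define v where "v z = (if ?good n z then s (ii z) (cc z) + (1 - s (cc z) (jj z)) else 1)" for z
      have F: "F \<alpha> [z, e, n] = Some (v z)" for z
        using side[of "ii z" "cc z"] side[of "cc z" "jj z"]
        by (auto simp: F_def v_def close_codes_def)
      have "\<exists>a c b. a < c \<and> c < b \<and> b < a + ?\<epsilon> \<and>
          s (inv q a) (inv q c) = 0 \<and> \<not> s (inv q c) (inv q b) = 0"
      proof (rule ex_close_sides)
        fix a b :: rat assume "a < b"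
        then show "if s (inv q a) (inv q b) = 0 then fst x a \<noteq> {} else snd x b \<noteq> {}"
          using side[of "inv q a" "inv q b"] by (auto simp: surj_f_inv_f[OF surj])
      qed simp
      then obtain a c b where abc: "a < c" "c < b" "b < a + ?\<epsilon>"
        "s (inv q a) (inv q c) = 0" "s (inv q c) (inv q b) \<noteq> 0" by blast
      \<comment> \<open>The search halts because \<open>shift_clamp a\<close> itself is an
        admissible approximation: the image of the interval from \<open>a\<close> to
        \<open>b\<close> is shorter than \<open>?\<epsilon>\<close>.\<close>
      define z where "z = prod_encode (inv q (shift_clamp a), prod_encode (inv q a,
        prod_encode (inv q c, inv q b)))"
      have z: "mm z = inv q (shift_clamp a)" "ii z = inv q a" "cc z = inv q c" "jj z = inv q b"
        by (simp_all add: z_def mm_def ii_def cc_def jj_def)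
      have "shift_clamp b < shift_clamp a + ?\<epsilon>"
        using shift_clamp_diff_le[of a b] abc by linarith
      then have "?good n z"
        using abc by (simp add: close_codes_def z surj_f_inv_f[OF surj])
      then have "v z = 0"
        using abc by (simp add: v_def z)
      then have ex: "\<exists>z. v z = 0" by blast
      define l where "l = (LEAST z. v z = 0)"
      have "v l = 0" unfolding l_def using ex by (rule LeastI_ex)
      then have l: "?good n l" "s (ii l) (cc l) = 0" "s (cc l) (jj l) \<noteq> 0"
        by (auto simp: v_def split: if_splits)
      let ?i = "q (ii l)" and ?j = "q (jj l)" and ?m = "q (mm l)"
      have good: "?i < q (cc l)" "q (cc l) < ?j" "shift_clamp ?j < ?m + ?\<epsilon>"
        "?m < shift_clamp ?i + ?\<epsilon>"
        using l(1) by (simp_all add: close_codes_def)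
      \<comment> \<open>The search may stop at another quadruple than \<open>z\<close>, but its two
        answers still enclose the real.\<close>
      have "fst x ?i \<noteq> {}" "snd x ?j \<noteq> {}"
        using side[OF good(1)] side[OF good(2)] l by auto
      then have "of_rat ?i \<le> ?y" "?y \<le> of_rat ?j"
        using L_less_cut_real cut_real_less_U by (simp_all add: less_imp_le)
      then have "of_rat (shift_clamp ?i) \<le> shift_clamp ?y" "shift_clamp ?y \<le> of_rat (shift_clamp ?j)"
        unfolding of_rat_shift_clamp by (simp_all add: shift_clamp_mono)
      moreover have "of_rat (shift_clamp ?j) < (of_rat (?m + ?\<epsilon>) :: real)"
        "of_rat ?m < (of_rat (shift_clamp ?i + ?\<epsilon>) :: real)"
        using good by (simp_all only: of_rat_less)
      ultimately have "\<bar>shift_clamp ?y - of_rat ?m\<bar> < (1/2) ^ n"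
        by (simp add: of_rat_add of_rat_power of_rat_divide abs_less_iff)
      moreover have "\<phi> \<alpha> (g e) n = Some (mm l)"
        using f[of "[e, n]" \<alpha> v, OF _ F ex] by (simp add: g l_def)
      ultimately show "\<exists>k. \<phi> \<alpha> (g e) n = Some k \<and> \<bar>shift_clamp ?y - of_rat (q k)\<bar> < (1/2) ^ n"
        by blast
    qed
    moreover have "snd x 0 \<noteq> {} \<Longrightarrow> ?y < 0" "fst x 0 \<noteq> {} \<Longrightarrow> 0 < ?y"
      using cut_real_less_U[of 0] L_less_cut_real[of 0] by simp_all
    ultimately show ?thesis by blast
  qed
  with g(1) show ?thesis by blast
qed

text \<open>Two reals within (1/2)^n of the same rational for every n coincide.\<close>

lemma represents_unique:
  assumes "represents q f x" "represents q f y" shows "x = y"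
proof (rule ccontr)
  assume "x \<noteq> y"
  then obtain n where n: "(1/2 :: real) ^ n < \<bar>x - y\<bar> / 2"
    using real_arch_pow_inv[of "\<bar>x - y\<bar> / 2" "1/2"] by auto
  obtain k where "f n = Some k" "\<bar>x - of_rat (q k)\<bar> < (1/2) ^ n"
    using assms(1) unfolding represents_def by blast
  moreover obtain k' where "f n = Some k'" "\<bar>y - of_rat (q k')\<bar> < (1/2) ^ n"
    using assms(2) unfolding represents_def by blast
  ultimately show False using n by (auto simp: abs_if split: if_splits)
qed

text \<open>Any number realizes a true truth value, so only the tag has to be computed, and the
  queried bit supplies it.\<close>

lemma entails_sign:
  assumes M_def: "M = seq_oracles pr \<mu>" and pr: "computable_pairing pr" and \<mu>: "miller \<phi> pr q \<mu>"
  shows "entails T (\<lambda>x. dedekind_reals T q x x)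
    (\<lambda>x. t_disj T (truth_value (snd x 0 = {})) (truth_value (fst x 0 = {})))"
proof -
  obtain g where g: "computable g"
    "\<And>x e. e \<in> dedekind_reals T q x x \<Longrightarrow> \<exists>y. \<forall>\<alpha>\<in>M. represents q (\<phi> \<alpha> (g e)) (shift_clamp y) \<and>
      (snd x 0 \<noteq> {} \<longrightarrow> y < 0) \<and> (fst x 0 \<noteq> {} \<longrightarrow> 0 < y)"
    using ex_index_of_real by blast
  have pr2: "computable2 pr" using pr by (simp add: computable_pairing_def)
  define l r where "l = cpair T (ctrue T) 0" and "r = cpair T (cfalse T) 0"
  \<comment> \<open>The list is \<open>[m, e]\<close> with a dummy \<open>m\<close>, set to
    \<open>0\<close> later. The bit read is the first digit of the entry of \<open>\<mu>\<close> at
    index \<open>g e\<close>.\<close>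
  have "rec_in 2 (\<lambda>\<alpha> xs.
      Option.bind (Option.bind (Some (pr (g (xs ! 1)) 0)) (\<lambda>n. Some (of_bool (\<alpha> n) :: nat)))
        (\<lambda>b. Some (if 0 < b then l else r)))" (is "rec_in 2 ?F")
  proof -
    have "decidable 1 (\<lambda>xs. 0 < xs ! 0)"
      by (intro decidable_less total_rec_const total_rec_nth) simp
    then have "total_rec 1 (\<lambda>xs. if 0 < xs ! 0 then l else r)"
      by (intro total_rec_if total_rec_const)
    then obtain e where "\<And>\<alpha> xs. length xs = 1 \<Longrightarrow> peval \<alpha> e xs = Some (if 0 < xs ! 0 then l else r)"
      unfolding rec_in_def by blast
    then have e: "peval \<alpha> e [b] = Some (if 0 < b then l else r)" for \<alpha> b by simp
    show ?thesis
    proof (rule rec_in_comp1, rule e, rule rec_in_comp1)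
      show "peval \<alpha> Oracle [n] = Some (of_bool (\<alpha> n))" for \<alpha> n by simp
      have "total_rec 2 (\<lambda>xs. g (xs ! 1))"
        by (rule total_rec_computable[OF g(1)], rule total_rec_nth) simp
      then show "total_rec 2 (\<lambda>xs. pr (g (xs ! 1)) 0)"
        by (rule total_rec_computable2[OF pr2]) (rule total_rec_const)
    qed
  qed
  then obtain c where "\<And>\<alpha> m n. \<phi> \<alpha> (c m) n = ?F \<alpha> [m, n]" by (rule rec_in_smn) blast
  then have c: "\<phi> \<alpha> (c 0) e = Some (if \<alpha> (pr (g e) 0) then l else r)" for \<alpha> e by simp
  show ?thesis
  proof (rule entailsI[OF ppca_T, of _ _ "c 0"])
    fix x e \<alpha> assume e: "e \<in> dedekind_reals T q x x" and "\<alpha> \<in> params T"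
    then have \<alpha>: "\<alpha> \<in> M" by (simp add: params_T)
    obtain y where y: "\<And>\<beta>. \<beta> \<in> M \<Longrightarrow> represents q (\<phi> \<beta> (g e)) (shift_clamp y)"
      and U: "snd x 0 \<noteq> {} \<Longrightarrow> y < 0" and L: "fst x 0 \<noteq> {} \<Longrightarrow> 0 < y"
      using g(2)[OF e] \<alpha> by blast
    have "seq_index \<phi> pr q \<mu> (g e) (shift_clamp y)"
      using y shift_clamp_interval by (simp add: seq_index_def M_def)
    then have "seq_index \<phi> pr q \<mu> (g e) (\<mu> (g e))" using \<mu> unfolding miller_def by blast
    then have "represents q (\<phi> \<alpha> (g e)) (\<mu> (g e))" using \<alpha> by (simp add: seq_index_def M_def)
    then have "shift_clamp y = \<mu> (g e)" using y[OF \<alpha>] by (rule represents_unique[rotated])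
    also have "\<dots> = bin_real (\<lambda>m. \<alpha> (pr (g e) m))"
      using \<alpha> by (auto simp: M_def seq_oracles_def bin_seq_def)
    finally have digit: "shift_clamp y = bin_real (\<lambda>m. \<alpha> (pr (g e) m))" .
    show "\<exists>d\<in>t_disj T (truth_value (snd x 0 = {})) (truth_value (fst x 0 = {})).
        app T \<alpha> (c 0) e = Some d"
    proof (cases "\<alpha> (pr (g e) 0)")
      case True
      then have "0 \<le> y"
        using bin_real_first_digit(1)[of "\<lambda>m. \<alpha> (pr (g e) m)"]
          shift_clamp_ge_half[of y] digit by simp
      then have "snd x 0 = {}" using U by fastforce
      with True show ?thesis by (auto simp: app_T c l_def t_disj_def truth_value_def)
    next
      case False
      then have "y \<le> 0"
        using bin_real_first_digit(2)[of "\<lambda>m. \<alpha> (pr (g e) m)"]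
          shift_clamp_le_half[of y] digit by simp
      then have "fst x 0 = {}" using L by fastforce
      with False show ?thesis by (auto simp: app_T c r_def t_disj_def truth_value_def)
    qed
  qed
qed

end

section \<open>From the sign to the inequality of cuts\<close>

context
  fixes T :: "('p, nat) app_struct" and q :: "nat \<Rightarrow> rat"
  assumes T: "ppca T" and q: "surj q"
begin

text \<open>The same realizer works, as it is only run on elements of \<open>\<psi> z\<close>. This
  lets classical facts about nonempty predicates enter entailments.\<close>

lemma ent_weaken:
  assumes "entails T \<psi> \<theta>" and "\<And>z. \<psi> z \<noteq> {} \<Longrightarrow> \<theta> z \<subseteq> \<theta>' z"
  shows "entails T \<psi> \<theta>'"
proof -
  obtain a where a: "\<And>z b p. b \<in> \<psi> z \<Longrightarrow> p \<in> params T \<Longrightarrow> \<exists>c\<in>\<theta> z. app T p a b = Some c"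
    using assms(1) unfolding entails_def by blast
  show ?thesis
    by (rule entailsI[OF T, of _ _ a]) (use a assms(2) in blast)
qed

lemma ent_truth_value: "(\<And>z. \<psi> z \<noteq> {} \<Longrightarrow> P z) \<Longrightarrow> entails T \<psi> (\<lambda>z. truth_value (P z))"
  by (rule ent_weaken[OF ent_top[OF T]]) (auto simp: truth_value_def)

lemma ent_rat_object_const: "entails T \<psi> (\<lambda>z. rat_object q r r)"
proof -
  obtain c where "c \<in> rat_object q r r" using rat_object_nonempty[OF T q] by blast
  then show ?thesis
    by (intro entailsI[OF T, of _ _ "cK1 T c"]) (auto simp: app_K1[OF T])
qed

text \<open>Dropping the tag loses which disjunct is realized, which does no harm once one of them
  is known to be empty.\<close>

lemma ent_disj_union: "entails T (\<lambda>z. t_disj T (A z) (B z)) (\<lambda>z. A z \<union> B z)"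
proof (rule ent_disjE'[OF T])
  show "entails T A (\<lambda>z. A z \<union> B z)" "entails T B (\<lambda>z. A z \<union> B z)"
    by (rule ent_weaken[OF ent_refl[OF T]], blast)+
qed

lemma ent_located:
  assumes x: "entails T \<psi> (\<lambda>z. dedekind_reals T q (x z) (x z))"
    and a: "entails T \<psi> (\<lambda>z. rat_object q (a z) (a z))"
    and b: "entails T \<psi> (\<lambda>z. rat_object q (b z) (b z))"
    and less: "\<And>z. \<psi> z \<noteq> {} \<Longrightarrow> a z < b z"
  shows "entails T \<psi> (\<lambda>z. fst (x z) (a z) \<union> snd (x z) (b z))"
proof -
  have "entails T \<psi> (\<lambda>z. locatedness T q (x z))"
    by (rule ent_trans[OF T x ent_reindex[OF T entails_locatedness[OF T q]]])
  note 1 = this[unfolded locatedness_def rat_all_def all_in_def]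
  note 2 = ent_mp[OF T ent_allE[OF T 1, of a] a]
  note 3 = ent_mp[OF T ent_allE[OF T 2, of b] b]
  note 4 = ent_mp[OF T 3 ent_truth_value[OF less]]
  show ?thesis by (rule ent_trans[OF T 4 ent_disj_union])
qed

lemmas nonempty = t_conj_nonempty truth_value_nonempty

text \<open>For \<open>a < 0\<close>, locatedness between \<open>a\<close> and \<open>0\<close> can
  only answer on the lower side. Conversely, the upper cut is upward closed and omits
  \<open>0\<close>, so its members are positive.\<close>

lemma ent_zero_le:
  "entails T (\<lambda>x. t_conj T (truth_value (snd x 0 = {})) (dedekind_reals T q x x))
     (\<lambda>x. real_le T q (rat_cut T q 0) x)" (is "entails T ?H _")
  unfolding real_le_def
proof (rule ent_conjI[OF T])
  let ?E = "\<lambda>a. rat_object q a a"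
  let ?S = "\<lambda>z. t_conj T (t_conj T (?H (fst z)) (?E (snd z)))
    (t_conj T (?E (snd z)) (truth_value (snd z < 0)))"
  have "entails T ?S (\<lambda>z. fst (fst z) (snd z) \<union> snd (fst z) 0)"
  proof (rule ent_located)
    show "entails T ?S (\<lambda>z. dedekind_reals T q (fst z) (fst z))"
      by (rule ent_conjD2[OF T ent_conjD1[OF T ent_fst[OF T]]])
    show "entails T ?S (\<lambda>z. ?E (snd z))"
      by (rule ent_conjD2[OF T ent_fst[OF T]])
  qed (rule ent_rat_object_const, unfold nonempty, blast)
  \<comment> \<open>The hypothesis makes the upper part of the union empty.\<close>
  then have "entails T ?S (\<lambda>z. fst (fst z) (snd z))"
    by (rule ent_weaken) (unfold nonempty, blast)
  then show "entails T ?H (\<lambda>x. rat_all T q (\<lambda>a. t_imp T (fst (rat_cut T q 0) a) (fst x a)))"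
    unfolding rat_all_def all_in_def rat_cut_def fst_conv
    by - (rule ent_allI[OF T], unfold split_beta, rule ent_impI[OF T], rule ent_impI[OF T])
  let ?R = "\<lambda>z. t_conj T (t_conj T (?H (fst z)) (?E (snd z))) (snd (fst z) (snd z))"
  have "entails T ?R (\<lambda>z. t_conj T (?E (snd z)) (truth_value (0 < snd z)))"
  proof (rule ent_conjI[OF T ent_conjD2[OF T ent_fst[OF T]] ent_truth_value])
    fix z :: "cut \<times> rat" assume "?R z \<noteq> {}"
    then have z: "snd (fst z) 0 = {}" "snd (fst z) (snd z) \<noteq> {}"
      "dedekind_reals T q (fst z) (fst z) \<noteq> {}" unfolding nonempty by blast+
    interpret rational_cut "\<lambda>a. fst (fst z) a \<noteq> {}" "\<lambda>b. snd (fst z) b \<noteq> {}"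
      by (rule rational_cut_dedekind[OF T q z(3)])
    show "0 < snd z" using U_upward[OF z(2), of 0] z(1) by force
  qed
  then show "entails T ?H (\<lambda>x. rat_all T q (\<lambda>b. t_imp T (snd x b) (snd (rat_cut T q 0) b)))"
    unfolding rat_all_def all_in_def rat_cut_def snd_conv
    by - (rule ent_allI[OF T], unfold split_beta, rule ent_impI[OF T], rule ent_impI[OF T])
qed

text \<open>The mirror image: locatedness is asked between \<open>0\<close> and a positive
  rational.\<close>

lemma ent_le_zero:
  "entails T (\<lambda>x. t_conj T (truth_value (fst x 0 = {})) (dedekind_reals T q x x))
     (\<lambda>x. real_le T q x (rat_cut T q 0))" (is "entails T ?H _")
  unfolding real_le_def
proof (rule ent_conjI[OF T])
  let ?E = "\<lambda>a. rat_object q a a"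
  let ?R = "\<lambda>z. t_conj T (t_conj T (?H (fst z)) (?E (snd z))) (fst (fst z) (snd z))"
  have "entails T ?R (\<lambda>z. t_conj T (?E (snd z)) (truth_value (snd z < 0)))"
  proof (rule ent_conjI[OF T ent_conjD2[OF T ent_fst[OF T]] ent_truth_value])
    fix z :: "cut \<times> rat" assume "?R z \<noteq> {}"
    then have z: "fst (fst z) 0 = {}" "fst (fst z) (snd z) \<noteq> {}"
      "dedekind_reals T q (fst z) (fst z) \<noteq> {}" unfolding nonempty by blast+
    interpret rational_cut "\<lambda>a. fst (fst z) a \<noteq> {}" "\<lambda>b. snd (fst z) b \<noteq> {}"
      by (rule rational_cut_dedekind[OF T q z(3)])
    show "snd z < 0" using L_downward[OF z(2), of 0] z(1) by force
  qed
  then show "entails T ?H (\<lambda>x. rat_all T q (\<lambda>a. t_imp T (fst x a) (fst (rat_cut T q 0) a)))"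
    unfolding rat_all_def all_in_def rat_cut_def fst_conv
    by - (rule ent_allI[OF T], unfold split_beta, rule ent_impI[OF T], rule ent_impI[OF T])
  let ?S = "\<lambda>z. t_conj T (t_conj T (?H (fst z)) (?E (snd z)))
    (t_conj T (?E (snd z)) (truth_value (0 < snd z)))"
  have "entails T ?S (\<lambda>z. fst (fst z) 0 \<union> snd (fst z) (snd z))"
  proof (rule ent_located)
    show "entails T ?S (\<lambda>z. dedekind_reals T q (fst z) (fst z))"
      by (rule ent_conjD2[OF T ent_conjD1[OF T ent_fst[OF T]]])
    show "entails T ?S (\<lambda>z. ?E (snd z))"
      by (rule ent_conjD2[OF T ent_fst[OF T]])
  qed (rule ent_rat_object_const, unfold nonempty, blast)
  then have "entails T ?S (\<lambda>z. snd (fst z) (snd z))"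
    by (rule ent_weaken) (unfold nonempty, blast)
  then show "entails T ?H (\<lambda>x. rat_all T q (\<lambda>b. t_imp T (snd (rat_cut T q 0) b) (snd x b)))"
    unfolding rat_all_def all_in_def rat_cut_def snd_conv
    by - (rule ent_allI[OF T], unfold split_beta, rule ent_impI[OF T], rule ent_impI[OF T])
qed

end

theorem theorem7p7:
  fixes \<phi> :: "(nat \<Rightarrow> bool) \<Rightarrow> nat \<Rightarrow> nat \<Rightarrow> nat option"
    and pr :: "nat \<Rightarrow> nat \<Rightarrow> nat"
    and q :: "nat \<Rightarrow> rat"
    and \<mu> :: "nat \<Rightarrow> real"
    and T\<^sub>\<mu> :: "(nat \<Rightarrow> bool, nat) app_struct" (structure)
  assumes "acceptable \<phi>" and "computable_pairing pr" and "computable_rat_enum q"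
    and "miller \<phi> pr q \<mu>"
    and "T\<^sub>\<mu> = oracle_struct \<phi> (seq_oracles pr \<mu>)"
  shows "\<^bold>\<turnstile> all_in T\<^sub>\<mu> (dedekind_reals T\<^sub>\<mu> q)
    (\<lambda>x. real_le T\<^sub>\<mu> q (rat_cut T\<^sub>\<mu> q 0) x \<^bold>\<or> real_le T\<^sub>\<mu> q x (rat_cut T\<^sub>\<mu> q 0))"
proof -
  have M: "seq_oracles pr \<mu> \<noteq> {}"
    using assms(2,4) by (intro seq_oracles_nonempty) (simp_all add: miller_def)
  have T: "ppca T\<^sub>\<mu>" unfolding assms(5) by (rule ppca_oracle_struct[OF assms(1) M])
  have q: "surj q" using assms(3) by (simp add: computable_rat_enum_def bij_is_surj)
  let ?E = "\<lambda>x. dedekind_reals T\<^sub>\<mu> q x x"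
  let ?G = "\<lambda>x. real_le T\<^sub>\<mu> q (rat_cut T\<^sub>\<mu> q 0) x \<^bold>\<or> real_le T\<^sub>\<mu> q x (rat_cut T\<^sub>\<mu> q 0)"
  \<comment> \<open>Disjunction elimination has no side context, so the existence of
    \<open>x\<close> is moved to the right as the premise of an implication.\<close>
  have "(\<lambda>x. truth_value (snd x 0 = {}) \<^bold>\<or> truth_value (fst x 0 = {})) \<^bold>\<le> (\<lambda>x. ?E x \<^bold>\<longrightarrow> ?G x)"
    by (rule ent_disjE'[OF T]; rule ent_impI[OF T])
      (rule ent_disjI1[OF T ent_zero_le[OF T q]], rule ent_disjI2[OF T ent_le_zero[OF T q]])
  from ent_app[OF T this entails_sign[OF assms(1) M assms(3,5) refl assms(2,4)] ent_refl[OF T]]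
  have "?E \<^bold>\<le> ?G" .
  \<comment> \<open>Reindexing along the projection adds the one-point context over which the
    universal quantifier is introduced.\<close>
  then have "(\<lambda>z. ?E (snd z)) \<^bold>\<le> (\<lambda>z. ?G (snd z))" by (rule ent_reindex[OF T])
  then show ?thesis
    unfolding all_in_def
    by - (rule validI[OF T], rule ent_allI[OF T], unfold split_beta, rule ent_impI[OF T],
        rule ent_trans[OF T ent_snd[OF T]])
qed

end
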